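(* Let $d\ge2$, let $\Omega\subset\mathbb{R}^d$ be a bounded Lipschitz domain, let $\delta>0$ and let $\alpha=\alpha_\delta$ be the kernel described in the context. If $u\in W^{1,p}(\Omega)$ with $p>2$, then $\mathcal{L}_\alpha[u]\in L^2(\Omega)$.
   Context: Kernel: $\rho_\delta\in C^\infty([0,\infty);[0,\infty))$ satisfies $\int_{\mathbb{R}^d}\rho_\delta(|x|)\,dx=1$ and $\operatorname{supp}\rho_\delta\subset[0,\delta)$; $\alpha_\delta(x,y)=\frac{\sqrt{\rho_\delta(|x-y|)}}{|x-y|^2}(x-y)$ and $\mu(x,y)=|\alpha_\delta(x,y)|^2=\rho_\delta(|x-y|)/|x-y|^2$. Nonlocal Laplacian: $\mathcal{L}_\alpha[u](x)=2\int_\Omega(u(y)-u(x))\mu(x,y)\,dy$ for (a.e.) $x\in\Omega$. *)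

theory Defs
  imports "HOL-Analysis.Analysis"
begin

text \<open>
  Near each boundary point, \<open>\<Omega>\<close> is the epigraph, in some unit direction \<open>e\<close>, of a Lipschitz
  function on the hyperplane orthogonal to \<open>e\<close>. Letting \<open>e\<close> range over all unit vectors replaces
  the usual rotation of the coordinate system.
\<close>

definition lipschitz_boundary :: "'a::euclidean_space set \<Rightarrow> bool" where
  "lipschitz_boundary \<Omega> \<longleftrightarrow>
    (\<forall>z\<in>frontier \<Omega>. \<exists>r>0. \<exists>e L \<gamma>. norm e = 1 \<and>
       L-lipschitz_on {v. v \<bullet> e = 0} (\<gamma> :: 'a \<Rightarrow> real) \<and>
       \<Omega> \<inter> ball z r = {x \<in> ball z r. \<gamma> (x - (x \<bullet> e) *\<^sub>R e) < x \<bullet> e})"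

definition bounded_lipschitz_domain :: "'a::euclidean_space set \<Rightarrow> bool" where
  "bounded_lipschitz_domain \<Omega> \<longleftrightarrow>
    open \<Omega> \<and> connected \<Omega> \<and> \<Omega> \<noteq> {} \<and> bounded \<Omega> \<and> lipschitz_boundary \<Omega>"

primrec Ck :: "nat \<Rightarrow> ('a::euclidean_space \<Rightarrow> real) \<Rightarrow> bool" where
  "Ck 0 f \<longleftrightarrow> continuous_on UNIV f"
| "Ck (Suc n) f \<longleftrightarrow>
    (\<forall>x. f differentiable (at x)) \<and> (\<forall>i\<in>Basis. Ck n (\<lambda>x. frechet_derivative f (at x) i))"

text \<open>Elements of \<open>C\<^sub>c\<^sup>\<infinity>(\<Omega>)\<close> are represented by their extensions by zero to the whole space.\<close>

definition test_function :: "'a::euclidean_space set \<Rightarrow> ('a \<Rightarrow> real) \<Rightarrow> bool" where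
  "test_function \<Omega> \<phi> \<longleftrightarrow>
    (\<forall>n. Ck n \<phi>) \<and> (\<exists>K. compact K \<and> K \<subseteq> \<Omega> \<and> (\<forall>x. x \<notin> K \<longrightarrow> \<phi> x = 0))"

text \<open>Intended for exponents \<open>1 \<le> p \<le> \<infinity>\<close>. Values of functions outside \<open>\<Omega>\<close> are irrelevant
  throughout, since all integrals and null sets refer to \<open>lebesgue_on \<Omega>\<close>.\<close>

definition in_Lp :: "ennreal \<Rightarrow> 'a::euclidean_space set \<Rightarrow> ('a \<Rightarrow> real) \<Rightarrow> bool" where
  "in_Lp p \<Omega> f \<longleftrightarrow> f \<in> borel_measurable (lebesgue_on \<Omega>) \<and>
    (if p = \<infinity> then \<exists>C. AE x in lebesgue_on \<Omega>. \<bar>f x\<bar> \<le> C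
     else integrable (lebesgue_on \<Omega>) (\<lambda>x. \<bar>f x\<bar> powr enn2real p))"

definition weak_partial_derivative ::
    "'a::euclidean_space set \<Rightarrow> 'a \<Rightarrow> ('a \<Rightarrow> real) \<Rightarrow> ('a \<Rightarrow> real) \<Rightarrow> bool" where
  "weak_partial_derivative \<Omega> i u g \<longleftrightarrow>
    (\<forall>\<phi>. test_function \<Omega> \<phi> \<longrightarrow>
      integral\<^sup>L (lebesgue_on \<Omega>) (\<lambda>x. u x * frechet_derivative \<phi> (at x) i) =
      - integral\<^sup>L (lebesgue_on \<Omega>) (\<lambda>x. g x * \<phi> x))"

definition in_W1p :: "ennreal \<Rightarrow> 'a::euclidean_space set \<Rightarrow> ('a \<Rightarrow> real) \<Rightarrow> bool" where
  "in_W1p p \<Omega> u \<longleftrightarrow> in_Lp p \<Omega> u \<and>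
    (\<forall>i\<in>Basis. \<exists>g. in_Lp p \<Omega> g \<and> weak_partial_derivative \<Omega> i u g)"

text \<open>\<open>C\<^sup>\<infinity>\<close> on the closed half-line: \<open>D n\<close> is the \<open>n\<close>-th derivative, one-sided at \<open>0\<close>.\<close>

definition smooth_on_half_line :: "(real \<Rightarrow> real) \<Rightarrow> bool" where
  "smooth_on_half_line f \<longleftrightarrow>
    (\<exists>D :: nat \<Rightarrow> real \<Rightarrow> real. (\<forall>t\<ge>0. D 0 t = f t) \<and>
      (\<forall>n. \<forall>t\<ge>0. (D n has_real_derivative D (Suc n) t) (at t within {0..})))"

text \<open>The type argument fixes the space over which the radial kernel is normalised. The Bochner
  integral of a non-integrable function is \<open>0\<close>, so the value \<open>1\<close> entails integrability.\<close>

definition radial_kernel :: "'a::euclidean_space itself \<Rightarrow> real \<Rightarrow> (real \<Rightarrow> real) \<Rightarrow> bool" where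
  "radial_kernel _ \<delta> \<rho> \<longleftrightarrow>
    smooth_on_half_line \<rho> \<and> (\<forall>t\<ge>0. 0 \<le> \<rho> t) \<and>
    integral\<^sup>L lebesgue (\<lambda>x::'a. \<rho> (norm x)) = 1 \<and>
    closure {t \<in> {0..}. \<rho> t \<noteq> 0} \<subseteq> {0..<\<delta>}"

text \<open>On the diagonal, division by zero yields \<open>\<alpha> = 0\<close>; for each \<open>x\<close> this affects only the
  null set \<open>{x}\<close>.\<close>

definition alpha_kernel :: "(real \<Rightarrow> real) \<Rightarrow> 'a::euclidean_space \<Rightarrow> 'a \<Rightarrow> 'a" where
  "alpha_kernel \<rho> x y = (sqrt (\<rho> (norm (x - y))) / (norm (x - y))\<^sup>2) *\<^sub>R (x - y)"

definition mu_kernel :: "('a::euclidean_space \<Rightarrow> 'a \<Rightarrow> 'a) \<Rightarrow> 'a \<Rightarrow> 'a \<Rightarrow> real" where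
  "mu_kernel \<alpha> x y = (norm (\<alpha> x y))\<^sup>2"

definition nonlocal_laplacian ::
    "'a::euclidean_space set \<Rightarrow> ('a \<Rightarrow> 'a \<Rightarrow> 'a) \<Rightarrow> ('a \<Rightarrow> real) \<Rightarrow> 'a \<Rightarrow> real" where
  "nonlocal_laplacian \<Omega> \<alpha> u x =
    2 * integral\<^sup>L (lebesgue_on \<Omega>) (\<lambda>y. (u y - u x) * mu_kernel \<alpha> x y)"

text \<open>Convergence of the defining integral has to be stated separately, because the Bochner
  integral is \<open>0\<close> wherever the integrand is not integrable.\<close>

definition nonlocal_laplacian_exists_at ::
    "'a::euclidean_space set \<Rightarrow> ('a \<Rightarrow> 'a \<Rightarrow> 'a) \<Rightarrow> ('a \<Rightarrow> real) \<Rightarrow> 'a \<Rightarrow> bool" where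
  "nonlocal_laplacian_exists_at \<Omega> \<alpha> u x \<longleftrightarrow>
    integrable (lebesgue_on \<Omega>) (\<lambda>y. (u y - u x) * mu_kernel \<alpha> x y)"

end

theory Submission
  imports Defs
begin

text \<open>
  No extension operator is used. With \<open>d x = dist(x, -\<Omega>)\<close>, \<open>s = (p - 2) / (4 p)\<close> and
  \<open>K = (u y - u x)\<^sup>2 \<bar>x - y\<bar> powr (-2 - s)\<close>, it suffices by Cauchy--Schwarz that \<open>K\<close> is integrable over
  \<open>\<Omega> \<times> \<Omega>\<close>, since \<open>\<bar>h\<bar> powr (-2 + s)\<close> is locally integrable in dimension at least two. If \<open>\<bar>x - y\<bar> < d x\<close>
  (or \<open>< d y\<close>) the segment lies in \<open>\<Omega>\<close>, and
  \<open>\<integral> \<bar>u (x + h) - u x\<bar>\<^sup>2 dx \<le> \<bar>h\<bar>\<^sup>2 \<parallel>\<nabla>u\<parallel>\<^sup>2\<close> follows by duality against test functions. The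
  remaining pairs contribute at most a multiple of \<open>\<integral> u\<^sup>2 d powr (-2 s)\<close>, which Young's inequality
  bounds by \<open>\<integral> \<bar>u\<bar> powr p + \<integral> d powr (-1/2)\<close>; the Lipschitz boundary makes the last integral finite,
  and this is where \<open>p > 2\<close> enters.
\<close>

subsection \<open>Power singularities and translations\<close>

text \<open>The exponent \<open>-2\<close> is the borderline: in dimension two
  \<open>norm h powr (-2)\<close> is not locally integrable, so the differences of \<open>u\<close>
  must supply a positive power. The gain \<open>s\<close> is pulled in several directions.
  Cauchy-Schwarz splits \<open>-2\<close> into the halves of \<open>-2 - s\<close> and
  \<open>-2 + s\<close>, which asks for \<open>s > 0\<close>. Close pairs gain two powers from the
  gradient and leave \<open>norm h powr (-s)\<close>. Pairs far apart relative to \<open>d\<close>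
  may be joined by a segment that leaves the domain, so no smallness of \<open>u y - u x\<close> is
  available; there \<open>norm h powr (-2 - s)\<close> is traded for \<open>d powr (-2 * s)\<close>
  times \<open>norm h powr (-2 + s)\<close>. Young's inequality with exponents \<open>p / 2\<close>
  and \<open>p / (p - 2)\<close> then raises the weight to
  \<open>d powr (-2 * s * p / (p - 2))\<close>, whose exponent must exceed -1. The choice of
  \<open>s\<close> makes it -1/2; any fixed value strictly between -1 and 0 would serve. For
  infinite \<open>p\<close> a finite exponent \<open>q > 2\<close> takes its place. All functions
  are replaced by Borel representatives that vanish off the domain, so that Fubini and translation
  invariance can be applied on the whole space.\<close>

lemma nn_integral_abs_powr_finite:
  fixes b R :: real
  assumes "b < 1"
  shows "(\<integral>\<^sup>+t. ennreal (\<bar>t\<bar> powr (-b) * indicator {-R..R} t) \<partial>lborel) < \<infinity>"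
proof -
  \<comment> \<open>For negative \<open>R\<close> the indicator vanishes; the clipped radius keeps
    the half-line power integral applicable.\<close>
  define R' where "R' = max R 0"
  have *: "(\<integral>\<^sup>+t. ennreal (t powr (-b)) * indicator {0..R'} t \<partial>lborel) = ennreal (R' powr (-b+1) / (-b+1))"
    by (rule nn_integral_has_integral_lebesgue'[OF _ has_integral_powr_from_0])
       (use assms in \<open>auto simp: R'_def\<close>)
  have **: "(\<integral>\<^sup>+t. ennreal ((-t) powr (-b)) * indicator {0..R'} (-t) \<partial>lborel) = ennreal (R' powr (-b+1) / (-b+1))"
    unfolding *[symmetric] by (subst nn_integral_real_affine[where c = "-1" and t = 0]) auto
  have "(\<integral>\<^sup>+t. ennreal (\<bar>t\<bar> powr (-b) * indicator {-R..R} t) \<partial>lborel)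
    \<le> (\<integral>\<^sup>+t. ennreal (t powr (-b)) * indicator {0..R'} t + ennreal ((-t) powr (-b)) * indicator {0..R'} (-t) \<partial>lborel)"
    by (rule nn_integral_mono) (auto simp: indicator_def R'_def abs_if)
  also have "\<dots> = ennreal (R' powr (-b+1) / (-b+1)) + ennreal (R' powr (-b+1) / (-b+1))"
    by (subst nn_integral_add) (auto simp: * **)
  also have "\<dots> < \<infinity>" by (simp add: ennreal_plus[symmetric] del: ennreal_plus)
  finally show ?thesis .
qed

text \<open>Tensorisation in place of polar coordinates: each coordinate is at most the norm, so
  \<open>norm h powr (-a)\<close> is at most the product of the one-dimensional powers with exponent
  \<open>-a / DIM('a)\<close>, which is above -1. The ball is enlarged to the cube at the same
  time.\<close>

lemma nn_integral_norm_powr_finite: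
  fixes a R :: real
  assumes "0 \<le> a" "a < DIM('a)"
  shows "(\<integral>\<^sup>+h. ennreal (norm h powr (-a) * indicator (cball 0 R) h) \<partial>(lborel::'a::euclidean_space measure)) < \<infinity>"
proof -
  define b where "b = a / DIM('a)"
  have b: "b < 1" "b * DIM('a) = a" "0 \<le> b" using assms by (auto simp: b_def)
  let ?f = "\<lambda>t::real. ennreal (\<bar>t\<bar> powr (-b) * indicator {-R..R} t)"
  have pt: "norm h powr (-a) * indicator (cball 0 R) h
      \<le> (\<Prod>i\<in>Basis. \<bar>h \<bullet> i\<bar> powr (-b) * indicator {-R..R} (h \<bullet> i))"
    if "\<forall>i\<in>Basis. h \<bullet> i \<noteq> 0" for h :: 'a
  proof (cases "h \<in> cball 0 R")
    case True
    have 1: "\<bar>h \<bullet> i\<bar> \<le> R" if "i \<in> Basis" for i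
      using Basis_le_norm[OF that, of h] True by simp
    have hn: "h \<noteq> 0" using that nonempty_Basis by fastforce
    have "norm h powr (-a) = (\<Prod>i\<in>(Basis::'a set). norm h powr (-b))"
      using hn by (simp add: powr_power b mult.commute)
    also have "\<dots> \<le> (\<Prod>i\<in>Basis. \<bar>h \<bullet> i\<bar> powr (-b))"
      using that b Basis_le_norm[of _ h] by (intro prod_mono conjI) (auto intro!: powr_mono2')
    also have "\<dots> = (\<Prod>i\<in>Basis. \<bar>h \<bullet> i\<bar> powr (-b) * indicator {-R..R} (h \<bullet> i))"
      using 1 by (intro prod.cong) (auto simp: indicator_def abs_le_iff dest!: 1)
    finally show ?thesis using True by simp
  qed (auto intro!: prod_nonneg)
  \<comment> \<open>On a coordinate hyperplane the comparison breaks down, because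
    \<open>0 powr (-b) = 0\<close> makes the product vanish; these points form a null set.\<close>
  have nz: "AE h in lborel. \<forall>i\<in>Basis. (h::'a) \<bullet> i \<noteq> 0"
  proof (subst AE_finite_all)
    show "\<forall>i\<in>(Basis::'a set). AE h in lborel. h \<bullet> i \<noteq> 0"
    proof
      fix i :: 'a assume i: "i \<in> Basis"
      have "negligible {h::'a. h \<bullet> i = 0}" by (rule negligible_standard_hyperplane[OF i])
      then have "{h::'a. h \<bullet> i = 0} \<in> null_sets lborel"
        by (simp add: negligible_iff_null_sets null_sets_completion_iff)
      then show "AE h in lborel. h \<bullet> i \<noteq> 0" by (rule AE_I') auto
    qed
  qed auto
  have "(\<integral>\<^sup>+h. ennreal (norm h powr (-a) * indicator (cball 0 R) h) \<partial>(lborel::'a measure))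
     \<le> (\<integral>\<^sup>+h. (\<Prod>i\<in>Basis. ?f (h \<bullet> i)) \<partial>(lborel::'a measure))"
    by (rule nn_integral_mono_AE, rule AE_mp[OF nz], rule AE_I2)
       (use pt in \<open>auto simp: prod_ennreal intro!: ennreal_leI\<close>)
  also have "\<dots> = (\<Prod>i\<in>(Basis::'a set). (\<integral>\<^sup>+t. ?f t \<partial>lborel))"
    by (rule nn_integral_lborel_prod) auto
  also have "\<dots> < \<infinity>" using nn_integral_abs_powr_finite[OF b(1), of R]
    by (simp add: power_less_top_ennreal)
  finally show ?thesis .
qed

lemma nn_integral_lborel_shift:
  fixes c :: "'a::euclidean_space"
  assumes [measurable]: "f \<in> borel_measurable borel"
  shows "(\<integral>\<^sup>+x. f (x + c) \<partial>lborel) = (\<integral>\<^sup>+x. f x \<partial>lborel)"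
  by (subst (2) lborel_distr_plus[of c, symmetric]) (simp add: nn_integral_distr add.commute)

lemma nn_integral_lborel_uminus:
  assumes [measurable]: "f \<in> borel_measurable borel"
  shows "(\<integral>\<^sup>+x. f (- x) \<partial>(lborel::'a::euclidean_space measure)) = (\<integral>\<^sup>+x. f x \<partial>lborel)"
  by (subst (2) lborel_affine[of "-1" "0::'a"]) (simp_all add: nn_integral_density nn_integral_distr)

lemma nn_integral_lborel_diff:
  fixes c :: "'a::euclidean_space"
  assumes [measurable]: "f \<in> borel_measurable borel"
  shows "(\<integral>\<^sup>+x. f (c - x) \<partial>lborel) = (\<integral>\<^sup>+x. f x \<partial>lborel)"
  using nn_integral_lborel_shift[of "\<lambda>x. f (- x)" "- c"] nn_integral_lborel_uminus[of f] by simp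

lemma integral_lborel_shift:
  fixes c :: "'a::euclidean_space" and f :: "'a \<Rightarrow> real"
  assumes [measurable]: "f \<in> borel_measurable borel"
  shows "(\<integral>x. f (x + c) \<partial>lborel) = (\<integral>x. f x \<partial>lborel)"
  by (subst (2) lborel_distr_plus[of c, symmetric]) (simp add: integral_distr add.commute)

lemma integrable_lborel_shift:
  fixes c :: "'a::euclidean_space" and f :: "'a \<Rightarrow> real"
  assumes "integrable lborel f"
  shows "integrable lborel (\<lambda>x. f (x + c))"
  using integrable_distr[of "(+) c" lborel lborel f] assms lborel_distr_plus[of c]
  by (simp add: add.commute cong: distr_cong)

subsection \<open>The boundary layer of a Lipschitz domain\<close>

text \<open>Averaging the left-hand side over the translates by \<open>s e\<close>, \<open>0 \<le> s \<le> 1\<close>, turns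
  the values \<open>t x\<close> into the values \<open>t x + s\<close>. This replaces Fubini's theorem in coordinates
  adapted to the direction \<open>e\<close>.\<close>

lemma nn_integral_ball_translation_le:
  fixes t :: "'a::euclidean_space \<Rightarrow> real" and f :: "real \<Rightarrow> ennreal"
  assumes [measurable]: "t \<in> borel_measurable borel" "f \<in> borel_measurable borel"
    and e: "norm e = 1" and t: "\<And>x s. t (x + s *\<^sub>R e) = t x + s"
  shows "(\<integral>\<^sup>+x. indicator (ball z r) x * f (t x) \<partial>lborel)
    \<le> emeasure lborel (ball z (r + 1)) * (\<integral>\<^sup>+\<tau>. f \<tau> \<partial>lborel)"
proof -
  let ?I = "\<integral>\<^sup>+x. indicator (ball z r) x * f (t x) \<partial>lborel"
  have [measurable]: "ball z r \<in> sets borel" "ball z (r + 1) \<in> sets borel" by auto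
  have M: "(\<lambda>x. indicator (ball z r) x * f (t x)) \<in> borel_measurable borel" by measurable
  have "?I = (\<integral>\<^sup>+s. indicator {0..1::real} s * ?I \<partial>lborel)"
    by (subst nn_integral_multc) auto
  also have "\<dots> = (\<integral>\<^sup>+s. (\<integral>\<^sup>+x. indicator {0..1} s * (indicator (ball z r) (x + s *\<^sub>R e) * f (t x + s)) \<partial>lborel) \<partial>lborel)"
  proof (rule nn_integral_cong)
    fix s :: real
    have "?I = (\<integral>\<^sup>+x. indicator (ball z r) (x + s *\<^sub>R e) * f (t x + s) \<partial>lborel)"
      using nn_integral_lborel_shift[OF M, of "s *\<^sub>R e"] by (simp only: t)
    then show "indicator {0..1} s * ?I
      = (\<integral>\<^sup>+x. indicator {0..1} s * (indicator (ball z r) (x + s *\<^sub>R e) * f (t x + s)) \<partial>lborel)"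
      by (subst nn_integral_cmult) auto
  qed
  \<comment> \<open>A shift of length at most 1 stays inside the larger ball. Once the indicator no
    longer involves \<open>s\<close>, the \<open>s\<close>-integral is a full integral of
    \<open>f\<close>, the same for every \<open>x\<close>.\<close>
  also have "\<dots> \<le> (\<integral>\<^sup>+s. (\<integral>\<^sup>+x. indicator (ball z (r + 1)) x * f (t x + s) \<partial>lborel) \<partial>lborel)"
  proof (intro nn_integral_mono)
    fix s x
    have "x \<in> ball z (r + 1)" if "s \<in> {0..1}" "x + s *\<^sub>R e \<in> ball z r"
    proof -
      have "dist z x \<le> dist z (x + s *\<^sub>R e) + norm (s *\<^sub>R e)"
        using dist_triangle[of z x "x + s *\<^sub>R e"] by (simp add: dist_norm)
      then show ?thesis using that e by simp
    qed
    then show "indicator {0..1} s * (indicator (ball z r) (x + s *\<^sub>R e) * f (t x + s))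
        \<le> indicator (ball z (r + 1)) x * f (t x + s)"
      by (auto simp: indicator_def)
  qed
  also have "\<dots> = (\<integral>\<^sup>+x. (\<integral>\<^sup>+s. indicator (ball z (r + 1)) x * f (t x + s) \<partial>lborel) \<partial>lborel)"
    by (rule lborel_pair.Fubini') measurable
  also have "\<dots> = (\<integral>\<^sup>+x. indicator (ball z (r + 1)) x * (\<integral>\<^sup>+\<tau>. f \<tau> \<partial>lborel) \<partial>lborel)"
  proof (rule nn_integral_cong)
    fix x :: 'a
    have "(\<integral>\<^sup>+s. f (t x + s) \<partial>lborel) = (\<integral>\<^sup>+\<tau>. f \<tau> \<partial>lborel)"
      using nn_integral_lborel_shift[of f "t x"] by (simp add: add.commute)
    then show "(\<integral>\<^sup>+s. indicator (ball z (r + 1)) x * f (t x + s) \<partial>lborel)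
      = indicator (ball z (r + 1)) x * (\<integral>\<^sup>+\<tau>. f \<tau> \<partial>lborel)"
      by (subst nn_integral_cmult) auto
  qed
  also have "\<dots> = emeasure lborel (ball z (r + 1)) * (\<integral>\<^sup>+\<tau>. f \<tau> \<partial>lborel)"
    by (subst nn_integral_multc) auto
  finally show ?thesis .
qed

lemma infdist_geI:
  assumes "A \<noteq> {}" "\<And>y. y \<in> A \<Longrightarrow> m \<le> dist x y"
  shows "m \<le> infdist x A"
  using assms by (auto simp: infdist_notempty intro!: cINF_greatest)

text \<open>The height \<open>t\<close> above the graph is \<open>(1 + L)\<close>-Lipschitz and
  nonpositive at points of the chart outside the domain. Hence the distance to the complement is at
  least \<open>t x / (1 + L)\<close>, unless the competing point lies outside the chart; shrinking
  the radius to \<open>r/3\<close> keeps such points at distance \<open>2 * r / 3\<close>. This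
  reduces the claim to a one-variable power integral in \<open>t\<close>.\<close>

lemma lipschitz_epigraph_layer:
  fixes \<Omega> :: "'a::euclidean_space set" and \<gamma> :: "'a \<Rightarrow> real"
  assumes ne: "- \<Omega> \<noteq> {}" and r: "r > 0" and e: "norm e = 1"
    and lip: "L-lipschitz_on {v. v \<bullet> e = 0} \<gamma>"
    and epi: "\<Omega> \<inter> ball z r = {x \<in> ball z r. \<gamma> (x - (x \<bullet> e) *\<^sub>R e) < x \<bullet> e}"
    and b: "0 \<le> b" "b < 1"
  shows "(\<integral>\<^sup>+x. indicator (\<Omega> \<inter> ball z (r/3)) x * ennreal (infdist x (- \<Omega>) powr (-b)) \<partial>lborel) < \<infinity>"
proof -
  define P where "P = (\<lambda>x. x - (x \<bullet> e) *\<^sub>R e)"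
  define t where "t = (\<lambda>x. x \<bullet> e - \<gamma> (P x))"
  have ee: "e \<bullet> e = 1" using e by (simp add: dot_square_norm)
  have P: "P x \<bullet> e = 0" for x by (simp add: P_def inner_diff_left ee)
  have L: "L \<ge> 0" using lip by (rule lipschitz_on_nonneg)
  have "continuous_on UNIV P" unfolding P_def by (intro continuous_intros)
  then have "continuous_on UNIV (\<lambda>x. \<gamma> (P x))"
    by (rule continuous_on_compose2[OF lipschitz_on_continuous_on[OF lip]]) (use P in blast)
  then have [measurable]: "t \<in> borel_measurable borel"
    unfolding t_def by (intro borel_measurable_continuous_onI continuous_intros)
  have t_shift: "t (x + s *\<^sub>R e) = t x + s" for x s
    by (simp add: t_def P_def inner_add_left ee scaleR_add_left algebra_simps)
  have t_lip: "t x - t y \<le> (1 + L) * dist x y" for x y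
  proof -
    have "norm (P x - P y) \<le> norm (x - y)"
    proof -
      have "(norm (P x - P y))\<^sup>2 + ((x - y) \<bullet> e)\<^sup>2 = (norm (x - y))\<^sup>2"
        unfolding power2_norm_eq_inner P_def
        by (simp add: inner_diff_left inner_diff_right ee inner_commute power2_eq_square algebra_simps)
      then have "(norm (P x - P y))\<^sup>2 \<le> (norm (x - y))\<^sup>2"
        using zero_le_power2[of "(x - y) \<bullet> e"] by linarith
      then show ?thesis by (rule power2_le_imp_le) auto
    qed
    then have "L * dist (P x) (P y) \<le> L * dist x y"
      using L by (auto simp: dist_norm intro: mult_left_mono)
    moreover have "\<bar>\<gamma> (P x) - \<gamma> (P y)\<bar> \<le> L * dist (P x) (P y)"
      using lipschitz_onD[OF lip, of "P x" "P y"] P by (simp add: dist_real_def)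
    moreover have "x \<bullet> e - y \<bullet> e \<le> dist x y"
      using Cauchy_Schwarz_ineq2[of "x - y" e] e by (simp add: inner_diff_left dist_norm)
    ultimately show ?thesis by (simp add: t_def algebra_simps abs_le_iff)
  qed
  have epi': "x \<in> \<Omega> \<longleftrightarrow> t x > 0" if "x \<in> ball z r" for x
  proof -
    have "x \<in> \<Omega> \<longleftrightarrow> x \<in> \<Omega> \<inter> ball z r" using that by simp
    also have "\<dots> \<longleftrightarrow> t x > 0" unfolding epi using that by (simp add: t_def P_def)
    finally show ?thesis .
  qed
  define f where "f = (\<lambda>\<tau>::real. ennreal (\<bar>\<tau>\<bar> powr (-b) * indicator {-1..1} \<tau>))"
  \<comment> \<open>Lower bound for the distance wherever comparison with
    \<open>\<bar>t x\<bar> powr (-b)\<close> is not made: either \<open>t x > 1\<close>, beyond the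
    cut-off in \<open>f\<close>, or the edge of the chart gives the smaller bound.\<close>
  define m where "m = min (1 / (1 + L)) (2 * r / 3)"
  have m: "m > 0" using r L by (simp add: m_def)
  have [measurable]: "f \<in> borel_measurable borel" unfolding f_def by measurable
  have [measurable]: "ball z (r/3) \<in> sets borel" by auto
  have [measurable]: "(\<lambda>x. indicator (ball z (r/3)) x * f (t x)) \<in> borel_measurable borel" by measurable
  have pt: "infdist x (- \<Omega>) powr (-b) \<le> (1 + L) powr b * (\<bar>t x\<bar> powr (-b) * indicator {-1..1} (t x)) + m powr (-b)"
    if x: "x \<in> \<Omega>" "x \<in> ball z (r/3)" for x
  proof -
    have "x \<in> ball z r" using x r by auto
    then have tx: "t x > 0" using epi' x by simp
    have d: "min (t x / (1 + L)) (2 * r / 3) \<le> infdist x (- \<Omega>)"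
    proof (rule infdist_geI[OF ne])
      fix y assume y: "y \<in> - \<Omega>"
      show "min (t x / (1 + L)) (2 * r / 3) \<le> dist x y"
      proof (cases "y \<in> ball z r")
        case True
        then have "t y \<le> 0" using epi' y by force
        then have "t x \<le> (1 + L) * dist x y" using t_lip[of x y] by linarith
        then have "t x / (1 + L) \<le> dist x y" using L by (simp add: field_simps)
        then show ?thesis by simp
      next
        case False
        then have "2 * r / 3 \<le> dist x y"
          using x dist_triangle[of z y x] by (simp add: dist_commute)
        then show ?thesis by simp
      qed
    qed
    show ?thesis
    proof (cases "t x \<le> 1 \<and> t x / (1 + L) \<le> 2 * r / 3")
      case True
      then have "infdist x (- \<Omega>) powr (-b) \<le> (t x / (1 + L)) powr (-b)"
        using d tx L b by (intro powr_mono2') auto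
      also have "\<dots> = (1 + L) powr b * \<bar>t x\<bar> powr (-b)"
        using tx L by (simp add: powr_divide powr_minus divide_simps)
      finally show ?thesis using True tx m by (simp add: indicator_def add_increasing2)
    next
      case False
      then have "m \<le> min (t x / (1 + L)) (2 * r / 3)"
        using L tx by (auto simp: m_def min_def divide_simps split: if_splits)
      then have "infdist x (- \<Omega>) powr (-b) \<le> m powr (-b)"
        using d m b by (intro powr_mono2') auto
      then show ?thesis by (simp add: add_increasing)
    qed
  qed
  have "(\<integral>\<^sup>+x. indicator (\<Omega> \<inter> ball z (r/3)) x * ennreal (infdist x (- \<Omega>) powr (-b)) \<partial>lborel)
    \<le> (\<integral>\<^sup>+x. ennreal ((1 + L) powr b) * (indicator (ball z (r/3)) x * f (t x))
          + ennreal (m powr (-b)) * indicator (ball z (r/3)) x \<partial>lborel)"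
  proof (rule nn_integral_mono)
    fix x
    show "indicator (\<Omega> \<inter> ball z (r/3)) x * ennreal (infdist x (- \<Omega>) powr (-b))
      \<le> ennreal ((1 + L) powr b) * (indicator (ball z (r/3)) x * f (t x))
          + ennreal (m powr (-b)) * indicator (ball z (r/3)) x"
    proof (cases "x \<in> \<Omega> \<inter> ball z (r/3)")
      case True
      then have "ennreal (infdist x (- \<Omega>) powr (-b))
        \<le> ennreal ((1 + L) powr b * (\<bar>t x\<bar> powr (-b) * indicator {-1..1} (t x)) + m powr (-b))"
        using pt[of x] by (intro ennreal_leI) auto
      also have "\<dots> = ennreal ((1 + L) powr b) * f (t x) + ennreal (m powr (-b))"
        by (simp add: f_def ennreal_mult ennreal_plus)
      finally show ?thesis using True by simp
    qed auto
  qed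
  also have "\<dots> = ennreal ((1 + L) powr b) * (\<integral>\<^sup>+x. indicator (ball z (r/3)) x * f (t x) \<partial>lborel)
      + ennreal (m powr (-b)) * emeasure lborel (ball z (r/3))"
    by (simp add: nn_integral_add nn_integral_cmult nn_integral_cmult_indicator)
  also have "\<dots> \<le> ennreal ((1 + L) powr b) * (emeasure lborel (ball z (r/3 + 1)) * (\<integral>\<^sup>+\<tau>. f \<tau> \<partial>lborel))
      + ennreal (m powr (-b)) * emeasure lborel (ball z (r/3))"
    by (intro add_right_mono mult_left_mono nn_integral_ball_translation_le[where e = e] e t_shift) auto
  also have "\<dots> < \<infinity>"
    using nn_integral_abs_powr_finite[OF b(2), of 1] emeasure_lborel_ball_finite
    by (auto simp: f_def ennreal_mult_less_top less_top)
  finally show ?thesis .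
qed

text \<open>Compactness: finitely many charts cover the frontier, and what they leave of the closure
  is a compact subset \<open>K\<close> of the open domain. The distance has a positive minimum on
  \<open>K\<close>, so the integrand is bounded there.\<close>

lemma lipschitz_domain_layer:
  fixes \<Omega> :: "'a::euclidean_space set"
  assumes dom: "bounded_lipschitz_domain \<Omega>" and b: "0 \<le> b" "b < 1"
  shows "(\<integral>\<^sup>+x. indicator \<Omega> x * ennreal (infdist x (- \<Omega>) powr (-b)) \<partial>lborel) < \<infinity>"
proof -
  from dom have op: "open \<Omega>" and bd: "bounded \<Omega>" and lip: "lipschitz_boundary \<Omega>"
    by (auto simp: bounded_lipschitz_domain_def)
  \<comment> \<open>By convention \<open>infdist x {} = 0\<close>, so lower bounds for the distance
    require a nonempty complement.\<close>
  have ne: "- \<Omega> \<noteq> {}" using bd not_bounded_UNIV by (metis Compl_empty_eq double_compl)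
  have [measurable]: "\<Omega> \<in> sets borel" using op by auto
  let ?g = "\<lambda>x. ennreal (infdist x (- \<Omega>) powr (-b))"
  have [measurable]: "(\<lambda>x. infdist x (- \<Omega>)) \<in> borel_measurable borel"
    by (intro borel_measurable_continuous_onI continuous_on_infdist continuous_on_id)
  have [measurable]: "(\<lambda>x. indicator (\<Omega> \<inter> ball z q) x * ?g x) \<in> borel_measurable borel" for z q
  proof -
    have [measurable]: "\<Omega> \<inter> ball z q \<in> sets borel" using op by auto
    show ?thesis by measurable
  qed
  have "\<exists>q>0. (\<integral>\<^sup>+x. indicator (\<Omega> \<inter> ball z q) x * ?g x \<partial>lborel) < \<infinity>"
    if z: "z \<in> frontier \<Omega>" for z
  proof -
    obtain r e L \<gamma> where "r > 0" "norm e = 1" "L-lipschitz_on {v. v \<bullet> e = 0} (\<gamma> :: 'a \<Rightarrow> real)"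
      "\<Omega> \<inter> ball z r = {x \<in> ball z r. \<gamma> (x - (x \<bullet> e) *\<^sub>R e) < x \<bullet> e}"
      using lip z unfolding lipschitz_boundary_def by blast
    from lipschitz_epigraph_layer[OF ne this b] \<open>r > 0\<close> show ?thesis
      by (intro exI[of _ "r/3"]) auto
  qed
  then obtain q where q: "\<And>z. z \<in> frontier \<Omega> \<Longrightarrow> q z > 0"
    "\<And>z. z \<in> frontier \<Omega> \<Longrightarrow> (\<integral>\<^sup>+x. indicator (\<Omega> \<inter> ball z (q z)) x * ?g x \<partial>lborel) < \<infinity>"
    by metis
  have "compact (frontier \<Omega>)" using bd by (simp add: compact_frontier_bounded)
  then obtain C where C: "C \<subseteq> frontier \<Omega>" "finite C" "frontier \<Omega> \<subseteq> (\<Union>z\<in>C. ball z (q z))"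
    by (rule compactE_image[where f = "\<lambda>z. ball z (q z)" and C = "frontier \<Omega>"]) (use q in auto)
  define K where "K = closure \<Omega> - (\<Union>z\<in>C. ball z (q z))"
  have "compact K" unfolding K_def using bd by (intro compact_diff) auto
  have K\<Omega>: "K \<subseteq> \<Omega>" using C(3) op by (auto simp: K_def frontier_def interior_open)
  obtain m where m: "m > 0" "\<And>x. x \<in> K \<Longrightarrow> m \<le> infdist x (- \<Omega>)"
  proof (cases "K = {}")
    case True
    then show ?thesis using that[of 1] by auto
  next
    case False
    obtain x0 where "x0 \<in> K" "\<And>x. x \<in> K \<Longrightarrow> infdist x0 (- \<Omega>) \<le> infdist x (- \<Omega>)"
      using continuous_attains_inf[OF \<open>compact K\<close> False continuous_on_infdist[OF continuous_on_id]]
      by blast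
    moreover from this have "infdist x0 (- \<Omega>) > 0"
      using K\<Omega> op ne by (intro infdist_pos_not_in_closed) auto
    ultimately show ?thesis using that by blast
  qed
  have "(\<integral>\<^sup>+x. indicator \<Omega> x * ?g x \<partial>lborel)
    \<le> (\<integral>\<^sup>+x. (\<Sum>z\<in>C. indicator (\<Omega> \<inter> ball z (q z)) x * ?g x) + ennreal (m powr (-b)) * indicator \<Omega> x \<partial>lborel)"
  proof (rule nn_integral_mono)
    fix x
    show "indicator \<Omega> x * ?g x
      \<le> (\<Sum>z\<in>C. indicator (\<Omega> \<inter> ball z (q z)) x * ?g x) + ennreal (m powr (-b)) * indicator \<Omega> x"
    proof (cases "x \<in> \<Omega>")
      case x: True
      show ?thesis
      proof (cases "x \<in> K")
        case True
        then have "?g x \<le> ennreal (m powr (-b))"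
          using m b by (intro ennreal_leI powr_mono2') auto
        then show ?thesis using x by (simp add: add_increasing)
      next
        case False
        then obtain z where z: "z \<in> C" "x \<in> ball z (q z)"
          using x closure_subset[of \<Omega>] by (auto simp: K_def)
        then have "?g x \<le> (\<Sum>z\<in>C. indicator (\<Omega> \<inter> ball z (q z)) x * ?g x)"
          using member_le_sum[of z C "\<lambda>z. indicator (\<Omega> \<inter> ball z (q z)) x * ?g x"] C(2) x by auto
        then show ?thesis using x by (simp add: add_increasing2)
      qed
    qed auto
  qed
  also have "\<dots> = (\<Sum>z\<in>C. \<integral>\<^sup>+x. indicator (\<Omega> \<inter> ball z (q z)) x * ?g x \<partial>lborel)
      + ennreal (m powr (-b)) * emeasure lborel \<Omega>"
    by (simp add: nn_integral_add nn_integral_cmult_indicator nn_integral_sum)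
  also have "\<dots> < \<infinity>"
    using q(2) C(1,2) emeasure_bounded_finite[OF bd]
    by (auto simp: ennreal_mult_less_top less_top)
  finally show ?thesis .
qed

subsection \<open>Smooth functions\<close>

text \<open>For \<open>m = 0\<close> this is the classical flat function. The negative powers are
  carried in the index because differentiation produces them: the linear span of the family is
  closed under derivatives.\<close>

definition exp_recip :: "nat \<Rightarrow> real \<Rightarrow> real" where
  "exp_recip m t = (if t > 0 then exp (- (1 / t)) / t ^ m else 0)"

lemma exp_recip_tendsto_0: "(exp_recip m \<longlongrightarrow> 0) (at_right 0)"
proof -
  have "((\<lambda>t::real. inverse t ^ m / exp (inverse t)) \<longlongrightarrow> 0) (at_right 0)"
    by (rule filterlim_compose[OF tendsto_power_div_exp_0 filterlim_inverse_at_top_right])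
  then show ?thesis
    by (rule Lim_transform_eventually)
       (auto simp: exp_recip_def eventually_at_filter exp_minus divide_simps power_inverse)
qed

lemma exp_recip_has_derivative:
  "(exp_recip m has_real_derivative exp_recip (m + 2) t - m * exp_recip (m + 1) t) (at t)"
proof -
  consider "t > 0" | "t < 0" | "t = 0" by linarith
  then show ?thesis
  proof cases
    case 1
    have "((\<lambda>t. exp (- (1 / t)) / t ^ m) has_real_derivative
        (exp (- (1 / t)) * (1 / (t * t)) * t ^ m - exp (- (1 / t)) * (real m * t ^ (m - Suc 0))) / (t ^ m * t ^ m)) (at t)"
      using 1 by (auto intro!: derivative_eq_intros)
    moreover have "real m * t ^ (m - Suc 0) = real m * t ^ m / t"
      using 1 by (cases m) auto
    then have "(exp (- (1 / t)) * (1 / (t * t)) * t ^ m - exp (- (1 / t)) * (real m * t ^ (m - Suc 0))) / (t ^ m * t ^ m)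
        = exp_recip (m + 2) t - m * exp_recip (m + 1) t"
      using 1 by (simp add: exp_recip_def) (simp add: field_simps)
    ultimately have "((\<lambda>t. exp (- (1 / t)) / t ^ m) has_real_derivative exp_recip (m + 2) t - m * exp_recip (m + 1) t) (at t)"
      by simp
    then show ?thesis
      by (rule DERIV_cong_ev[OF refl _ refl, THEN iffD2, rotated])
         (use 1 in \<open>auto simp: exp_recip_def eventually_nhds intro!: exI[of _ "{0<..}"]\<close>)
  next
    case 2
    have "((\<lambda>t::real. 0::real) has_real_derivative exp_recip (m + 2) t - m * exp_recip (m + 1) t) (at t)"
      using 2 by (auto simp: exp_recip_def)
    then show ?thesis
      by (rule DERIV_cong_ev[OF refl _ refl, THEN iffD2, rotated])
         (use 2 in \<open>auto simp: exp_recip_def eventually_nhds intro!: exI[of _ "{..<0}"]\<close>)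
  next
    case 3
    \<comment> \<open>At the origin the difference quotient is \<open>exp_recip (m + 1) h\<close>
      for positive \<open>h\<close> and 0 for negative \<open>h\<close>.\<close>
    have "((\<lambda>h. exp_recip m h / h) \<longlongrightarrow> 0) (at 0)"
    proof (rule filterlim_split_at)
      show "((\<lambda>h. exp_recip m h / h) \<longlongrightarrow> 0) (at_left 0)"
        by (rule tendsto_eventually) (auto simp: exp_recip_def eventually_at_filter)
      show "((\<lambda>h. exp_recip m h / h) \<longlongrightarrow> 0) (at_right 0)"
        by (rule Lim_transform_eventually[OF exp_recip_tendsto_0[of "Suc m"]])
           (auto simp: exp_recip_def eventually_at_filter)
    qed
    then show ?thesis using 3 by (simp add: DERIV_def exp_recip_def)
  qed
qed

text \<open>Closed under partial derivatives, so that every member is \<open>C\<^sup>\<infinity>\<close>.\<close>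

inductive elem_smooth :: "('a::euclidean_space \<Rightarrow> real) \<Rightarrow> bool" where
  const: "elem_smooth (\<lambda>x. c)"
| coord: "elem_smooth (\<lambda>x. x \<bullet> i)"
| add: "elem_smooth f \<Longrightarrow> elem_smooth g \<Longrightarrow> elem_smooth (\<lambda>x. f x + g x)"
| mult: "elem_smooth f \<Longrightarrow> elem_smooth g \<Longrightarrow> elem_smooth (\<lambda>x. f x * g x)"
| exp: "elem_smooth f \<Longrightarrow> elem_smooth (\<lambda>x. exp (f x))"
| recip: "elem_smooth f \<Longrightarrow> elem_smooth (\<lambda>x. exp_recip m (f x))"

lemma elem_smooth_derivative:
  assumes "elem_smooth f"
  shows "\<exists>f'. (\<forall>x. (f has_derivative f' x) (at x)) \<and> (\<forall>v. elem_smooth (\<lambda>x. f' x v))"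
  using assms
proof induction
  case (const c)
  then show ?case by (intro exI[of _ "\<lambda>x v. 0"]) (auto intro: elem_smooth.const)
next
  case (coord i)
  then show ?case
    by (intro exI[of _ "\<lambda>x v. v \<bullet> i"]) (auto intro!: elem_smooth.const derivative_eq_intros)
next
  case (add f g)
  then obtain f' g' where
    "\<forall>x. (f has_derivative f' x) (at x)" "\<forall>v. elem_smooth (\<lambda>x. f' x v)"
    "\<forall>x. (g has_derivative g' x) (at x)" "\<forall>v. elem_smooth (\<lambda>x. g' x v)" by blast
  then show ?case
    by (intro exI[of _ "\<lambda>x v. f' x v + g' x v"]) (auto intro!: elem_smooth.add has_derivative_add)
next
  case (mult f g)
  then obtain f' g' where
    "\<forall>x. (f has_derivative f' x) (at x)" "\<forall>v. elem_smooth (\<lambda>x. f' x v)"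
    "\<forall>x. (g has_derivative g' x) (at x)" "\<forall>v. elem_smooth (\<lambda>x. g' x v)" by blast
  with mult show ?case
    by (intro exI[of _ "\<lambda>x v. f x * g' x v + f' x v * g x"])
       (auto intro!: elem_smooth.add elem_smooth.mult has_derivative_mult)
next
  case (exp f)
  then obtain f' where
    *: "\<forall>x. (f has_derivative f' x) (at x)" "\<forall>v. elem_smooth (\<lambda>x. f' x v)" by blast
  have "((\<lambda>x. exp (f x)) has_derivative (\<lambda>v. exp (f x) * f' x v)) (at x)" for x
    using DERIV_compose_FDERIV[OF DERIV_exp, of f "f' x" x UNIV] * by (simp add: mult.commute)
  with exp * show ?case
    by (intro exI[of _ "\<lambda>x v. exp (f x) * f' x v"])
       (auto intro!: elem_smooth.mult elem_smooth.exp)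
next
  case (recip f m)
  then obtain f' where
    *: "\<forall>x. (f has_derivative f' x) (at x)" "\<forall>v. elem_smooth (\<lambda>x. f' x v)" by blast
  have "((\<lambda>x. exp_recip m (f x)) has_derivative
      (\<lambda>v. (exp_recip (m + 2) (f x) + (- real m) * exp_recip (m + 1) (f x)) * f' x v)) (at x)" for x
    using DERIV_compose_FDERIV[OF exp_recip_has_derivative, of f "f' x" x UNIV m] *
    by (simp add: mult.commute)
  moreover have "elem_smooth (\<lambda>x. (exp_recip (m + 2) (f x) + (- real m) * exp_recip (m + 1) (f x)) * f' x v)" for v
    using recip * by (intro elem_smooth.mult elem_smooth.add elem_smooth.const elem_smooth.recip) auto
  ultimately show ?case
    by (intro exI[of _ "\<lambda>x v. (exp_recip (m + 2) (f x) + (- real m) * exp_recip (m + 1) (f x)) * f' x v"])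
       blast
qed

lemma elem_smooth_has_derivative:
  "elem_smooth f \<Longrightarrow> (f has_derivative frechet_derivative f (at x)) (at x)"
  by (metis elem_smooth_derivative frechet_derivative_at)

lemma elem_smooth_frechet_derivative:
  assumes "elem_smooth f"
  shows "elem_smooth (\<lambda>x. frechet_derivative f (at x) v)"
proof -
  obtain f' where *: "\<forall>x. (f has_derivative f' x) (at x)" "\<forall>v. elem_smooth (\<lambda>x. f' x v)"
    using elem_smooth_derivative[OF assms] by blast
  then have "frechet_derivative f (at x) = f' x" for x by (metis frechet_derivative_at)
  with * show ?thesis by simp
qed

lemma elem_smooth_continuous: "elem_smooth f \<Longrightarrow> continuous_on A f"
  by (meson elem_smooth_has_derivative has_derivative_continuous continuous_at_imp_continuous_on)

lemma elem_smooth_measurable: "elem_smooth f \<Longrightarrow> f \<in> borel_measurable borel"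
  by (intro borel_measurable_continuous_onI elem_smooth_continuous)

lemma elem_smooth_Ck: "elem_smooth f \<Longrightarrow> Ck n f"
  by (induction n arbitrary: f)
     (auto simp: elem_smooth_continuous differentiable_def intro: elem_smooth_frechet_derivative elem_smooth_has_derivative)

lemma elem_smooth_diff: "elem_smooth f \<Longrightarrow> elem_smooth g \<Longrightarrow> elem_smooth (\<lambda>x. f x - g x)"
  using elem_smooth.add[OF _ elem_smooth.mult[OF elem_smooth.const[of "-1"]], of f g] by simp

lemma elem_smooth_prod:
  "finite I \<Longrightarrow> (\<And>i. i \<in> I \<Longrightarrow> elem_smooth (f i)) \<Longrightarrow> elem_smooth (\<lambda>x. \<Prod>i\<in>I. f i x)"
  by (induction I rule: finite_induct) (auto intro: elem_smooth.const elem_smooth.mult)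

text \<open>Only the generator \<open>coord\<close> changes, into a coordinate minus a constant.
  Needed because the duality argument moves test functions along \<open>h\<close>.\<close>

lemma elem_smooth_translate: "elem_smooth f \<Longrightarrow> elem_smooth (\<lambda>x. f (x - c))"
  by (induction rule: elem_smooth.induct)
     (auto simp: inner_diff_left intro: elem_smooth.intros intro!: elem_smooth_diff)

lemma elem_smooth_test_function:
  "elem_smooth f \<Longrightarrow> compact K \<Longrightarrow> K \<subseteq> U \<Longrightarrow> (\<And>x. x \<notin> K \<Longrightarrow> f x = 0) \<Longrightarrow> test_function U f"
  by (auto simp: test_function_def intro: elem_smooth_Ck)

lemma frechet_derivative_zero_outside:
  fixes f :: "'a::euclidean_space \<Rightarrow> real"
  assumes "closed K" "\<And>x. x \<notin> K \<Longrightarrow> f x = 0" "x \<notin> K"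
  shows "frechet_derivative f (at x) v = 0"
proof -
  have "(f has_derivative (\<lambda>v. 0)) (at x)"
    by (rule has_derivative_transform_within_open[OF has_derivative_const[of 0], of "- K"]) (use assms in auto)
  then show ?thesis by (metis frechet_derivative_at)
qed

lemma elem_smooth_bounded:
  assumes "elem_smooth f" "compact K" "\<And>x. x \<notin> K \<Longrightarrow> f x = 0"
  obtains B where "\<And>x. \<bar>f x\<bar> \<le> B"
proof -
  have "compact (f ` K)" using assms by (intro compact_continuous_image elem_smooth_continuous)
  then obtain B where "\<forall>x\<in>K. \<bar>f x\<bar> \<le> B" by (auto dest!: compact_imp_bounded simp: bounded_real)
  then have "\<bar>f x\<bar> \<le> max B 0" for x using assms(3)[of x] by (cases "x \<in> K") (auto simp: le_max_iff_disj)
  then show ?thesis using that by blast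
qed

text \<open>With \<open>w\<close> smooth and positive exactly on the box, \<open>1 - exp (- n w)\<close> increases to its indicator.\<close>

lemma box_smooth_approximation:
  fixes a b :: "'a::euclidean_space"
  obtains \<phi> :: "nat \<Rightarrow> 'a \<Rightarrow> real" where
    "\<And>n. elem_smooth (\<phi> n)" "\<And>n x. x \<notin> box a b \<Longrightarrow> \<phi> n x = 0"
    "\<And>n x. \<bar>\<phi> n x\<bar> \<le> 1" "\<And>x. (\<lambda>n. \<phi> n x) \<longlonglongrightarrow> indicator (box a b) x"
proof
  define w where "w = (\<lambda>x::'a. \<Prod>i\<in>Basis. exp_recip 0 (x \<bullet> i - a \<bullet> i) * exp_recip 0 (b \<bullet> i - x \<bullet> i))"
  let ?\<phi> = "\<lambda>n x. 1 - exp ((- real n) * w x)"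
  have "elem_smooth w" unfolding w_def
    by (intro elem_smooth_prod elem_smooth.mult elem_smooth.recip elem_smooth_diff elem_smooth.const elem_smooth.coord) auto
  then show "elem_smooth (?\<phi> n)" for n
    by (intro elem_smooth_diff elem_smooth.const elem_smooth.exp elem_smooth.mult)
  have w0: "w x \<ge> 0" for x by (auto simp: w_def exp_recip_def intro!: prod_nonneg)
  have w1: "w x > 0" if "x \<in> box a b" for x
    using that by (auto simp: w_def exp_recip_def mem_box intro!: prod_pos)
  have w2: "w x = 0" if "x \<notin> box a b" for x
    using that by (auto simp: w_def exp_recip_def mem_box intro!: prod_zero)
  show "?\<phi> n x = 0" if "x \<notin> box a b" for n x using w2[OF that] by simp
  show "\<bar>?\<phi> n x\<bar> \<le> 1" for n x using w0[of x] by (auto simp: abs_le_iff intro: add_increasing2)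
  show "(\<lambda>n. ?\<phi> n x) \<longlonglongrightarrow> indicator (box a b) x" for x
  proof (cases "x \<in> box a b")
    case True
    have "filterlim (\<lambda>n. w x * real n) at_top sequentially"
      using w1[OF True] by (rule filterlim_tendsto_pos_mult_at_top[OF tendsto_const]) (rule filterlim_real_sequentially)
    then have "filterlim (\<lambda>n. - (w x * real n)) at_bot sequentially"
      by (simp add: filterlim_uminus_at_top)
    then have "(\<lambda>n. exp (- (w x * real n))) \<longlonglongrightarrow> 0"
      by (rule filterlim_compose[OF exp_at_bot])
    then have "(\<lambda>n. 1 - exp (- (w x * real n))) \<longlonglongrightarrow> 1 - 0" by (intro tendsto_intros)
    with True show ?thesis by (simp add: mult.commute)
  next
    case False
    then show ?thesis by (simp add: w2)
  qed
qed

section \<open>The fundamental lemma of the calculus of variations\<close>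

text \<open>Smooth approximations of box indicators give integral zero over every box whose closed
  version lies in \<open>V\<close>. Boxes are stable under intersection and generate the Borel sets,
  so the integral vanishes over all Borel parts of such a box, and \<open>V\<close> is a countable
  union of closed boxes.\<close>

lemma AE_zero_if_orthogonal_to_test_functions:
  fixes W :: "'a::euclidean_space \<Rightarrow> real"
  assumes W: "integrable lborel W" and V: "open V"
    and orth: "\<And>\<phi> K. elem_smooth \<phi> \<Longrightarrow> compact K \<Longrightarrow> K \<subseteq> V \<Longrightarrow> (\<And>x. x \<notin> K \<Longrightarrow> \<phi> x = 0)
      \<Longrightarrow> (\<integral>x. W x * \<phi> x \<partial>lborel) = 0"
  shows "AE x in lborel. x \<in> V \<longrightarrow> W x = 0"
proof -
  have Wm [measurable]: "W \<in> borel_measurable borel" using W by auto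
  have box0: "(\<integral>x. W x * indicator (box a b) x \<partial>lborel) = 0" if "cbox a b \<subseteq> V" for a b
  proof -
    obtain \<phi> :: "nat \<Rightarrow> 'a \<Rightarrow> real" where \<phi>:
      "\<And>n. elem_smooth (\<phi> n)" "\<And>n x. x \<notin> box a b \<Longrightarrow> \<phi> n x = 0"
      "\<And>n x. \<bar>\<phi> n x\<bar> \<le> 1" "\<And>x. (\<lambda>n. \<phi> n x) \<longlonglongrightarrow> indicator (box a b) x"
      by (rule box_smooth_approximation[of a b]) metis
    have "(\<lambda>n. \<integral>x. W x * \<phi> n x \<partial>lborel) \<longlonglongrightarrow> (\<integral>x. W x * indicator (box a b) x \<partial>lborel)"
    proof (rule integral_dominated_convergence[where w = "\<lambda>x. \<bar>W x\<bar>"])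
      show "AE x in lborel. norm (W x * \<phi> n x) \<le> \<bar>W x\<bar>" for n
        using \<phi>(3) by (auto simp: abs_mult intro!: mult_left_le)
      show "(\<lambda>x. W x * \<phi> n x) \<in> borel_measurable lborel" for n
        using elem_smooth_measurable[OF \<phi>(1)[of n]] by simp
    qed (use W \<phi>(4) in \<open>auto intro!: tendsto_mult_left\<close>)
    moreover have "(\<integral>x. W x * \<phi> n x \<partial>lborel) = 0" for n
      by (rule orth[OF \<phi>(1) compact_cbox that]) (use \<phi>(2) box_subset_cbox in blast)
    ultimately show ?thesis by (simp add: LIMSEQ_const_iff)
  qed
  have cb: "AE x in lborel. x \<in> cbox a b \<longrightarrow> W x = 0" if ab: "cbox a b \<subseteq> V" for a b
  proof -
    \<comment> \<open>Cutting off by a fixed open box lets the induction run over all Borel sets of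
      the space: intersecting any generator with \<open>box a b\<close> again gives a box inside
      it.\<close>
    let ?W = "\<lambda>x. W x * indicator (box a b) x"
    have iW: "integrable lborel ?W" using W by (intro integrable_real_mult_indicator) auto
    have si: "set_integrable lborel B ?W" if "B \<in> sets borel" for B
      using integrable_mult_indicator[OF _ iW, of B] that by (simp add: set_integrable_def)
    have "set_lebesgue_integral lborel A ?W = 0" if "A \<in> sets lborel" for A
    proof -
      have "Int_stable (range (\<lambda>(c, d). box c (d::'a)))"
        by (auto simp: Int_stable_def box_Int_box)
      moreover have "range (\<lambda>(c, d). box c (d::'a)) \<subseteq> Pow UNIV" by auto
      moreover have "A \<in> sigma_sets UNIV (range (\<lambda>(c, d). box c d))"
        using that by (simp add: borel_eq_box sets_measure_of)
      ultimately show ?thesis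
      proof (induction A rule: sigma_sets_induct_disjoint)
        case (basic A)
        then obtain c d where A: "A = box c d" by auto
        obtain c' d' where cd: "box c d \<inter> box a b = box c' d'"
          using box_Int_box by blast
        have "set_lebesgue_integral lborel A ?W = (\<integral>x. W x * indicator (box c' d') x \<partial>lborel)"
          unfolding set_lebesgue_integral_def A cd[symmetric]
          by (intro Bochner_Integration.integral_cong) (auto simp: indicator_def)
        also have "\<dots> = 0"
        \<comment> \<open>An empty open box may have a nonempty, degenerate closed version outside
          \<open>V\<close>. Only for a nonempty one is \<open>cbox c' d'\<close> its closure, hence
          contained in \<open>cbox a b\<close>.\<close>
        proof (cases "box c' d' = {}")
          case False
          then have "cbox c' d' = closure (box c' d')" by simp
          also have "\<dots> \<subseteq> cbox a b"
            using cd box_subset_cbox[of a b] by (intro closure_minimal) auto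
          finally show ?thesis using ab by (intro box0) auto
        qed auto
        finally show ?case .
      next
        case (compl A)
        then have A: "A \<in> sets borel" by (simp add: borel_eq_box sets_measure_of)
        then have "set_lebesgue_integral lborel (UNIV - A) ?W + set_lebesgue_integral lborel A ?W
          = set_lebesgue_integral lborel (UNIV - A \<union> A) ?W"
          using A by (intro set_integral_Un[symmetric] si) auto
        also have "\<dots> = 0" using box0[OF ab] by (simp add: set_lebesgue_integral_def)
        finally show ?case using compl by simp
      next
        case (union A)
        then have A: "A i \<in> sets borel" for i by (simp add: borel_eq_box sets_measure_of range_subsetD)
        have "set_lebesgue_integral lborel (\<Union>i. A i) ?W = (\<Sum>i. set_lebesgue_integral lborel (A i) ?W)"
          using A union by (intro lebesgue_integral_countable_add si) (auto simp: disjoint_family_on_def)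
        then show ?case using union by simp
      qed (simp add: set_lebesgue_integral_def)
    qed
    then have "AE x in lborel. ?W x = 0" by (rule sigma_finite_measure.density_zero[OF sigma_finite_lborel iW])
    moreover have "AE x in lborel. x \<notin> cbox a b - box a b"
      by (rule AE_not_in[OF null_sets_cbox_Diff_box])
    ultimately show ?thesis by eventually_elim (auto simp: indicator_def split: if_splits)
  qed
  obtain D where D: "countable D" "\<And>X. X \<in> D \<Longrightarrow> \<exists>a b. X = cbox a b" "\<Union>D = V"
    using open_countable_Union_open_cbox[OF V] by metis
  have "AE x in lborel. x \<in> X \<longrightarrow> W x = 0" if "X \<in> D" for X
    using cb D(2,3) that by (metis Union_upper)
  then have "AE x in lborel. \<forall>X\<in>D. x \<in> X \<longrightarrow> W x = 0"
    using D(1) by (subst AE_ball_countable) auto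
  then show ?thesis
  proof eventually_elim
    case (elim x)
    show ?case
    proof
      assume "x \<in> V"
      then obtain X where "X \<in> D" "x \<in> X" by (auto simp: D(3)[symmetric])
      then show "W x = 0" using elim by blast
    qed
  qed
qed

subsection \<open>Weak derivatives and differences\<close>

lemma integrable_mult_bounded:
  fixes f g :: "'a \<Rightarrow> real"
  assumes f: "integrable M f" and [measurable]: "g \<in> borel_measurable M" and B: "\<And>x. \<bar>g x\<bar> \<le> B"
  shows "integrable M (\<lambda>x. f x * g x)"
proof (rule Bochner_Integration.integrable_bound)
  show "integrable M (\<lambda>x. B * f x)" using f by simp
  show "(\<lambda>x. f x * g x) \<in> borel_measurable M" using borel_measurable_integrable[OF f] by measurable
  have "\<bar>g x\<bar> \<le> \<bar>B\<bar>" for x using B[of x] by linarith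
  then show "AE x in M. norm (f x * g x) \<le> norm (B * f x)"
    by (intro AE_I2) (auto simp: abs_mult mult.commute[of "\<bar>B\<bar>"] intro: mult_left_mono)
qed

text \<open>Supplies the joint integrability behind the exchanges of integrals below. Each slice in
  \<open>t\<close> is a translate of \<open>F\<close>, so over the unit interval the total mass is
  that of \<open>F\<close>, and \<open>B\<close> costs a constant factor. The choice
  \<open>k = 0\<close> serves the function itself, \<open>k = h\<close> the directional derivative
  moving along the segment.\<close>

lemma integrable_strip:
  fixes F :: "'a::euclidean_space \<Rightarrow> real" and B :: "real \<times> 'a \<Rightarrow> real"
  assumes F: "integrable lborel F" and [measurable]: "B \<in> borel_measurable borel" and B: "\<And>z. \<bar>B z\<bar> \<le> M"
  shows "integrable (lborel \<Otimes>\<^sub>M lborel) (\<lambda>(t, x). indicator {0..1::real} t * (F (x + t *\<^sub>R k) * B (t, x)))"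
proof -
  have [measurable]: "F \<in> borel_measurable borel" using F by auto
  have [measurable]: "B \<in> borel_measurable (borel \<Otimes>\<^sub>M borel)" by (simp add: borel_prod)
  have "integrable (lborel \<Otimes>\<^sub>M lborel) (\<lambda>(t, x). indicator {0..1::real} t * F (x + t *\<^sub>R k))"
  proof (rule integrableI_bounded)
    have "(\<integral>\<^sup>+z. norm (case z of (t, x) \<Rightarrow> indicator {0..1::real} t * F (x + t *\<^sub>R k)) \<partial>(lborel \<Otimes>\<^sub>M lborel))
      = (\<integral>\<^sup>+t. \<integral>\<^sup>+x. indicator {0..1} t * ennreal \<bar>F (x + t *\<^sub>R k)\<bar> \<partial>lborel \<partial>lborel)"
      by (subst lborel.nn_integral_fst[symmetric])
         (auto simp: abs_mult indicator_def intro!: nn_integral_cong)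
    also have "\<dots> = (\<integral>\<^sup>+t. indicator {0..1::real} t * (\<integral>\<^sup>+x. ennreal \<bar>F x\<bar> \<partial>lborel) \<partial>lborel)"
      using nn_integral_lborel_shift[of "\<lambda>x. ennreal \<bar>F x\<bar>"] by (simp add: nn_integral_cmult)
    also have "\<dots> = (\<integral>\<^sup>+x. ennreal \<bar>F x\<bar> \<partial>lborel)"
      by (simp add: nn_integral_multc)
    also have "\<dots> < \<infinity>" using F by (simp add: integrable_iff_bounded)
    finally show "(\<integral>\<^sup>+z. norm (case z of (t, x) \<Rightarrow> indicator {0..1::real} t * F (x + t *\<^sub>R k)) \<partial>(lborel \<Otimes>\<^sub>M lborel)) < \<infinity>" .
  qed measurable
  from integrable_mult_bounded[OF this _ B] show ?thesis
    by (simp add: case_prod_unfold mult.assoc)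
qed

text \<open>The integrals are over the whole space, for functions extended by zero outside \<open>\<Omega>\<close>.\<close>

definition lborel_weak_derivative ::
    "'a::euclidean_space set \<Rightarrow> 'a \<Rightarrow> ('a \<Rightarrow> real) \<Rightarrow> ('a \<Rightarrow> real) \<Rightarrow> bool" where
  "lborel_weak_derivative \<Omega> i u g \<longleftrightarrow>
    (\<forall>\<phi>. test_function \<Omega> \<phi> \<longrightarrow>
      (\<integral>x. u x * frechet_derivative \<phi> (at x) i \<partial>lborel) = - (\<integral>x. g x * \<phi> x \<partial>lborel))"

text \<open>The fundamental theorem of calculus along segments, transferred to the test function.
  After a translation the difference of \<open>u\<close> acts as \<open>u y\<close> times
  \<open>\<phi> (y - h) - \<phi> y\<close>, to which the classical theorem applies. For each fixed
  \<open>t\<close> the weak derivative is then tested with \<open>\<phi>\<close> shifted by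
  \<open>t *\<^sub>R h\<close>, and Fubini restores the order of integration.\<close>

lemma weak_difference_quotient:
  fixes u :: "'a::euclidean_space \<Rightarrow> real" and g :: "'a \<Rightarrow> 'a \<Rightarrow> real" and h :: 'a
  assumes u: "integrable lborel u" and g: "\<And>i. i \<in> Basis \<Longrightarrow> integrable lborel (g i)"
    and weak: "\<And>i. i \<in> Basis \<Longrightarrow> lborel_weak_derivative \<Omega> i u (g i)"
    and V: "open V" "\<And>x t. x \<in> V \<Longrightarrow> t \<in> {0..1} \<Longrightarrow> x + t *\<^sub>R h \<in> \<Omega>"
  shows "AE x in lborel. x \<in> V \<longrightarrow>
    u (x + h) - u x = (\<integral>t. indicator {0..1} t * (\<Sum>i\<in>Basis. (h \<bullet> i) * g i (x + t *\<^sub>R h)) \<partial>lborel)"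
proof -
  define G where "G = (\<lambda>x. \<Sum>i\<in>Basis. (h \<bullet> i) * g i x)"
  have G: "integrable lborel G" unfolding G_def using g by auto
  define H where "H = (\<lambda>x. \<integral>t. indicator {0..1} t * G (x + t *\<^sub>R h) \<partial>lborel)"
  have [measurable]: "u \<in> borel_measurable borel" "G \<in> borel_measurable borel" using u G by auto
  have "integrable (lborel \<Otimes>\<^sub>M lborel) (\<lambda>(t, x). indicator {0..1::real} t * G (x + t *\<^sub>R h))"
    using integrable_strip[OF G, of "\<lambda>_. 1" 1 h] by simp
  from lborel_pair.integrable_snd[OF this] have H: "integrable lborel H"
    by (simp add: H_def)
  \<comment> \<open>The defect of the asserted identity; it is shown to be orthogonal to every
    elementary smooth function with compact support in \<open>V\<close>.\<close>
  define W where "W = (\<lambda>x. u (x + h) - u x - H x)"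
  have W: "integrable lborel W" unfolding W_def using u H integrable_lborel_shift[OF u] by auto
  have "AE x in lborel. x \<in> V \<longrightarrow> W x = 0"
  proof (rule AE_zero_if_orthogonal_to_test_functions[OF W V(1)])
    fix \<phi> :: "'a \<Rightarrow> real" and K
    assume \<phi>: "elem_smooth \<phi>" and K: "compact K" "K \<subseteq> V" "\<And>x. x \<notin> K \<Longrightarrow> \<phi> x = 0"
    have [measurable]: "\<phi> \<in> borel_measurable borel" using \<phi> by (rule elem_smooth_measurable)
    obtain C where C: "\<bar>\<phi> x\<bar> \<le> C" for x by (rule elem_smooth_bounded[OF \<phi> K(1) K(3)]) auto
    define D where "D = (\<lambda>x. frechet_derivative \<phi> (at x) h)"
    have D: "elem_smooth D" unfolding D_def by (rule elem_smooth_frechet_derivative[OF \<phi>])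
    then have [measurable]: "D \<in> borel_measurable borel" by (rule elem_smooth_measurable)
    have D0: "D x = 0" if "x \<notin> K" for x
      unfolding D_def by (rule frechet_derivative_zero_outside[OF compact_imp_closed[OF K(1)] K(3) that])
    obtain C' where C': "\<bar>D x\<bar> \<le> C'" for x by (rule elem_smooth_bounded[OF D K(1) D0]) auto
    have ftc: "(\<integral>t. indicator {0..1} t * D (y - t *\<^sub>R h) \<partial>lborel) = \<phi> y - \<phi> (y - h)" for y
    proof -
      \<comment> \<open>The sign compensates for the backward motion
        \<open>y - t *\<^sub>R h\<close>, so that the antiderivative has derivative \<open>D\<close>
        rather than its negative.\<close>
      have "((\<lambda>t. - \<phi> (y - t *\<^sub>R h)) has_vector_derivative D (y - t *\<^sub>R h)) (at t within {0..1})" for t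
      proof -
        have *: "((\<lambda>t. y - t *\<^sub>R h) has_derivative (\<lambda>s. - (s *\<^sub>R h))) (at t within {0..1})"
          by (auto intro!: derivative_eq_intros)
        have lin: "linear (frechet_derivative \<phi> (at (y - t *\<^sub>R h)))"
          using elem_smooth_has_derivative[OF \<phi>] by (rule has_derivative_linear)
        have "((\<lambda>t. \<phi> (y - t *\<^sub>R h)) has_derivative
           (\<lambda>s. frechet_derivative \<phi> (at (y - t *\<^sub>R h)) (- (s *\<^sub>R h)))) (at t within {0..1})"
          using has_derivative_compose[OF * elem_smooth_has_derivative[OF \<phi>]] .
        then have "((\<lambda>t. \<phi> (y - t *\<^sub>R h)) has_derivative (\<lambda>s. - (s * D (y - t *\<^sub>R h)))) (at t within {0..1})"
          by (simp add: linear_neg[OF lin] linear_scale[OF lin] D_def)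
        then show ?thesis
          unfolding has_vector_derivative_def by (auto dest: has_derivative_minus)
      qed
      moreover have "continuous_on {0..1} (\<lambda>t. D (y - t *\<^sub>R h))"
        by (rule continuous_on_compose2[OF elem_smooth_continuous[OF D, of UNIV]]) (auto intro!: continuous_intros)
      ultimately show ?thesis
        using integral_FTC_Icc[of 0 1 "\<lambda>t. - \<phi> (y - t *\<^sub>R h)" "\<lambda>t. D (y - t *\<^sub>R h)"] by simp
    qed
    have slice: "(\<integral>y. u y * D (y - t *\<^sub>R h) \<partial>lborel) = - (\<integral>x. G (x + t *\<^sub>R h) * \<phi> x \<partial>lborel)"
      if t: "t \<in> {0..1}" for t
    proof -
      \<comment> \<open>The shifted test function. Its support \<open>K'\<close> lies in the domain
        because the segments starting in \<open>V\<close> do.\<close>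
      define \<psi> where "\<psi> = (\<lambda>y. \<phi> (y - t *\<^sub>R h))"
      define K' where "K' = (\<lambda>x. x + t *\<^sub>R h) ` K"
      have \<psi>: "elem_smooth \<psi>" unfolding \<psi>_def by (rule elem_smooth_translate[OF \<phi>])
      have K': "compact K'" "K' \<subseteq> \<Omega>"
        using K V t unfolding K'_def by (auto intro!: compact_continuous_image continuous_intros)
      have \<psi>0: "\<psi> x = 0" if "x \<notin> K'" for x
      proof -
        have "x - t *\<^sub>R h \<notin> K"
        proof
          assume "x - t *\<^sub>R h \<in> K"
          then have "(x - t *\<^sub>R h) + t *\<^sub>R h \<in> K'" unfolding K'_def by (rule imageI)
          with that show False by simp
        qed
        then show ?thesis unfolding \<psi>_def by (rule K(3))
      qed
      have der: "frechet_derivative \<psi> (at y) = frechet_derivative \<phi> (at (y - t *\<^sub>R h))" for y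
      proof -
        have "((\<lambda>y. y - t *\<^sub>R h) has_derivative (\<lambda>v. v)) (at y)" by (auto intro!: derivative_eq_intros)
        from has_derivative_compose[OF this elem_smooth_has_derivative[OF \<phi>]]
        show ?thesis unfolding \<psi>_def by (simp add: frechet_derivative_at[symmetric])
      qed
      have i1: "integrable lborel (\<lambda>y. u y * frechet_derivative \<psi> (at y) i)" for i
      proof -
        have s: "elem_smooth (\<lambda>y. frechet_derivative \<psi> (at y) i)"
          by (rule elem_smooth_frechet_derivative[OF \<psi>])
        obtain B where "\<bar>frechet_derivative \<psi> (at y) i\<bar> \<le> B" for y
          by (rule elem_smooth_bounded[OF s K'(1) frechet_derivative_zero_outside[OF compact_imp_closed[OF K'(1)] \<psi>0]]) auto
        then show ?thesis using elem_smooth_measurable[OF s] by (intro integrable_mult_bounded[OF u]) auto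
      qed
      have i2: "integrable lborel (\<lambda>y. g i y * \<psi> y)" if "i \<in> Basis" for i
      proof -
        have "\<bar>\<psi> y\<bar> \<le> C" for y unfolding \<psi>_def by (rule C)
        then show ?thesis using elem_smooth_measurable[OF \<psi>] by (intro integrable_mult_bounded[OF g[OF that]]) auto
      qed
      have "D (y - t *\<^sub>R h) = (\<Sum>i\<in>Basis. (h \<bullet> i) * frechet_derivative \<psi> (at y) i)" for y
      proof -
        have lin: "linear (frechet_derivative \<psi> (at y))"
          using elem_smooth_has_derivative[OF \<psi>] by (rule has_derivative_linear)
        have "D (y - t *\<^sub>R h) = frechet_derivative \<psi> (at y) (\<Sum>i\<in>Basis. (h \<bullet> i) *\<^sub>R i)"
          by (simp add: D_def der euclidean_representation)
        then show ?thesis by (simp add: linear_sum[OF lin] linear_scale[OF lin])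
      qed
      then have "(\<integral>y. u y * D (y - t *\<^sub>R h) \<partial>lborel)
        = (\<integral>y. (\<Sum>i\<in>Basis. (h \<bullet> i) * (u y * frechet_derivative \<psi> (at y) i)) \<partial>lborel)"
        by (simp add: sum_distrib_left mult.left_commute)
      also have "\<dots> = (\<Sum>i\<in>Basis. (h \<bullet> i) * (\<integral>y. u y * frechet_derivative \<psi> (at y) i \<partial>lborel))"
        using i1 by (subst Bochner_Integration.integral_sum) auto
      also have "\<dots> = (\<Sum>i\<in>Basis. (h \<bullet> i) * - (\<integral>y. g i y * \<psi> y \<partial>lborel))"
        using weak elem_smooth_test_function[OF \<psi> K' \<psi>0] by (simp add: lborel_weak_derivative_def)
      also have "\<dots> = - (\<integral>y. (\<Sum>i\<in>Basis. (h \<bullet> i) * (g i y * \<psi> y)) \<partial>lborel)"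
        using i2 by (subst Bochner_Integration.integral_sum) (auto simp: sum_negf)
      also have "(\<integral>y. (\<Sum>i\<in>Basis. (h \<bullet> i) * (g i y * \<psi> y)) \<partial>lborel) = (\<integral>y. G y * \<phi> (y - t *\<^sub>R h) \<partial>lborel)"
        by (simp add: G_def \<psi>_def sum_distrib_right mult.assoc)
      also have "\<dots> = (\<integral>x. G (x + t *\<^sub>R h) * \<phi> x \<partial>lborel)"
        using integral_lborel_shift[of "\<lambda>y. G y * \<phi> (y - t *\<^sub>R h)" "t *\<^sub>R h"] by simp
      finally show ?thesis .
    qed
    have f1: "integrable (lborel \<Otimes>\<^sub>M lborel) (\<lambda>(t, y). indicator {0..1::real} t * (u y * D (y - t *\<^sub>R h)))"
      using integrable_strip[OF u, of "\<lambda>z. D (snd z - fst z *\<^sub>R h)" C' 0] C' by (simp add: borel_prod[symmetric])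
    have f2: "integrable (lborel \<Otimes>\<^sub>M lborel) (\<lambda>(t, x). indicator {0..1::real} t * (G (x + t *\<^sub>R h) * \<phi> x))"
      using integrable_strip[OF G, of "\<lambda>z. \<phi> (snd z)" C h] C by (simp add: borel_prod[symmetric])
    have iu: "integrable lborel (\<lambda>x. u x * \<phi> x)" "integrable lborel (\<lambda>x. u (x + h) * \<phi> x)"
      "integrable lborel (\<lambda>x. H x * \<phi> x)"
      using C by (auto intro!: integrable_mult_bounded u H integrable_lborel_shift)
    have iu': "integrable lborel (\<lambda>y. u y * \<phi> (y - h))"
      using C by (auto intro!: integrable_mult_bounded u)
    have "(\<integral>x. u (x + h) * \<phi> x \<partial>lborel) - (\<integral>x. u x * \<phi> x \<partial>lborel)
      = (\<integral>y. u y * \<phi> (y - h) \<partial>lborel) - (\<integral>x. u x * \<phi> x \<partial>lborel)"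
      using integral_lborel_shift[of "\<lambda>y. u y * \<phi> (y - h)" h] by simp
    also have "\<dots> = - (\<integral>y. u y * (\<phi> y - \<phi> (y - h)) \<partial>lborel)"
      using iu iu' by (simp add: right_diff_distrib)
    also have "(\<integral>y. u y * (\<phi> y - \<phi> (y - h)) \<partial>lborel)
      = (\<integral>y. (\<integral>t. indicator {0..1} t * (u y * D (y - t *\<^sub>R h)) \<partial>lborel) \<partial>lborel)"
      by (simp add: ftc[symmetric] mult.left_commute)
    also have "\<dots> = (\<integral>t. (\<integral>y. indicator {0..1} t * (u y * D (y - t *\<^sub>R h)) \<partial>lborel) \<partial>lborel)"
      by (rule lborel_pair.Fubini_integral[OF f1])
    also have "\<dots> = (\<integral>t. - (\<integral>x. indicator {0..1} t * (G (x + t *\<^sub>R h) * \<phi> x) \<partial>lborel) \<partial>lborel)"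
      by (intro Bochner_Integration.integral_cong refl) (auto simp: slice indicator_def)
    also have "\<dots> = - (\<integral>t. (\<integral>x. indicator {0..1} t * (G (x + t *\<^sub>R h) * \<phi> x) \<partial>lborel) \<partial>lborel)"
      by simp
    also have "(\<integral>t. (\<integral>x. indicator {0..1} t * (G (x + t *\<^sub>R h) * \<phi> x) \<partial>lborel) \<partial>lborel)
      = (\<integral>x. (\<integral>t. indicator {0..1} t * (G (x + t *\<^sub>R h) * \<phi> x) \<partial>lborel) \<partial>lborel)"
      by (rule lborel_pair.Fubini_integral[OF f2, symmetric])
    also have "\<dots> = (\<integral>x. H x * \<phi> x \<partial>lborel)"
      by (simp add: H_def mult.assoc[symmetric])
    finally show "(\<integral>x. W x * \<phi> x \<partial>lborel) = 0"
      using iu by (simp add: W_def left_diff_distrib)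
  qed
  then show ?thesis by (simp add: W_def H_def G_def)
qed

text \<open>For a function that is not integrable the Bochner integral is 0 and the bound is
  trivial. In this form it applies at points where convergence of a line integral or of the nonlocal
  integral is not known.\<close>

lemma ennreal_abs_integral_le:
  fixes f :: "'a \<Rightarrow> real"
  shows "ennreal \<bar>integral\<^sup>L M f\<bar> \<le> (\<integral>\<^sup>+x. ennreal \<bar>f x\<bar> \<partial>M)"
  using integral_norm_bound_ennreal[of M f]
  by (cases "integrable M f") (auto simp: not_integrable_integral_eq)

text \<open>Cauchy-Schwarz twice: over the coordinates, which yields \<open>norm h\<close>, and over
  the unit interval in \<open>t\<close>, where the constant is 1. Tonelli and translation invariance
  then give each slice in \<open>t\<close> the same integral of the squared gradient.\<close>

lemma weak_difference_L2_bound: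
  fixes u :: "'a::euclidean_space \<Rightarrow> real" and g :: "'a \<Rightarrow> 'a \<Rightarrow> real" and h :: 'a
  assumes u: "integrable lborel u" and g: "\<And>i. i \<in> Basis \<Longrightarrow> integrable lborel (g i)"
    and weak: "\<And>i. i \<in> Basis \<Longrightarrow> lborel_weak_derivative \<Omega> i u (g i)"
    and V: "open V" "\<And>x t. x \<in> V \<Longrightarrow> t \<in> {0..1} \<Longrightarrow> x + t *\<^sub>R h \<in> \<Omega>"
  shows "(\<integral>\<^sup>+x. indicator V x * ennreal ((u (x + h) - u x)\<^sup>2) \<partial>lborel)
    \<le> ennreal ((norm h)\<^sup>2) * (\<integral>\<^sup>+x. ennreal (\<Sum>i\<in>Basis. (g i x)\<^sup>2) \<partial>lborel)"
proof -
  define G where "G = (\<lambda>x. \<Sum>i\<in>Basis. (h \<bullet> i) * g i x)"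
  define N where "N = (\<lambda>x. \<Sum>i\<in>Basis. (g i x)\<^sup>2)"
  have gm: "g i \<in> borel_measurable borel" if "i \<in> Basis" for i using g[OF that] by auto
  have [measurable]: "u \<in> borel_measurable borel" using u by auto
  have [measurable]: "G \<in> borel_measurable borel" "N \<in> borel_measurable borel"
    unfolding G_def N_def using gm
    by (auto intro!: borel_measurable_sum borel_measurable_times borel_measurable_power)
  have [measurable]: "V \<in> sets borel" using V by auto
  have N0: "N x \<ge> 0" for x by (auto simp: N_def intro: sum_nonneg)
  have GN: "(G x)\<^sup>2 \<le> (norm h)\<^sup>2 * N x" for x
  proof -
    have "(norm h)\<^sup>2 = (\<Sum>i\<in>Basis. (h \<bullet> i)\<^sup>2)"
      unfolding power2_norm_eq_inner by (subst euclidean_inner) (simp add: power2_eq_square)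
    then show ?thesis unfolding G_def N_def by (simp add: Cauchy_Schwarz_ineq_sum)
  qed
  have pt: "ennreal ((\<integral>t. indicator {0..1} t * G (x + t *\<^sub>R h) \<partial>lborel)\<^sup>2)
      \<le> ennreal ((norm h)\<^sup>2) * (\<integral>\<^sup>+t. indicator {0..1} t * ennreal (N (x + t *\<^sub>R h)) \<partial>lborel)" for x
  proof -
    let ?a = "\<lambda>t. indicator {0..1::real} t * G (x + t *\<^sub>R h)"
    have "ennreal \<bar>\<integral>t. ?a t \<partial>lborel\<bar> \<le> (\<integral>\<^sup>+t. ennreal \<bar>?a t\<bar> \<partial>lborel)"
      by (rule ennreal_abs_integral_le)
    \<comment> \<open>The indicator is duplicated to serve as the second factor in Cauchy-Schwarz;
      its own square integral is 1.\<close>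
    also have "\<dots> = (\<integral>\<^sup>+t. indicator {0..1} t * ennreal \<bar>?a t\<bar> \<partial>lborel)"
      by (intro nn_integral_cong) (auto simp: indicator_def)
    finally have "(ennreal \<bar>\<integral>t. ?a t \<partial>lborel\<bar>)\<^sup>2 \<le> (\<integral>\<^sup>+t. indicator {0..1} t * ennreal \<bar>?a t\<bar> \<partial>lborel)\<^sup>2"
      by (intro power_mono) auto
    also have "\<dots> \<le> (\<integral>\<^sup>+t. (indicator {0..1::real} t)\<^sup>2 \<partial>lborel) * (\<integral>\<^sup>+t. (ennreal \<bar>?a t\<bar>)\<^sup>2 \<partial>lborel)"
      by (intro Cauchy_Schwarz_nn_integral) measurable
    also have "(\<integral>\<^sup>+t. (indicator {0..1::real} t)\<^sup>2 \<partial>lborel) = (\<integral>\<^sup>+t. indicator {0..1::real} t \<partial>lborel)"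
      by (intro nn_integral_cong) (auto simp: indicator_def)
    also have "\<dots> = 1" by simp
    also have "1 * (\<integral>\<^sup>+t. (ennreal \<bar>?a t\<bar>)\<^sup>2 \<partial>lborel)
      \<le> (\<integral>\<^sup>+t. ennreal ((norm h)\<^sup>2) * (indicator {0..1} t * ennreal (N (x + t *\<^sub>R h))) \<partial>lborel)"
      unfolding mult_1
    proof (intro nn_integral_mono)
      fix t
      show "(ennreal \<bar>?a t\<bar>)\<^sup>2 \<le> ennreal ((norm h)\<^sup>2) * (indicator {0..1} t * ennreal (N (x + t *\<^sub>R h)))"
        using GN[of "x + t *\<^sub>R h"] N0
        by (auto simp: indicator_def ennreal_power ennreal_mult[symmetric] intro!: ennreal_leI)
    qed
    also have "\<dots> = ennreal ((norm h)\<^sup>2) * (\<integral>\<^sup>+t. indicator {0..1} t * ennreal (N (x + t *\<^sub>R h)) \<partial>lborel)"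
      by (rule nn_integral_cmult) measurable
    finally show ?thesis by (simp add: ennreal_power)
  qed
  have quot: "AE x in lborel. x \<in> V \<longrightarrow>
      u (x + h) - u x = (\<integral>t. indicator {0..1} t * (\<Sum>i\<in>Basis. (h \<bullet> i) * g i (x + t *\<^sub>R h)) \<partial>lborel)"
    by (rule weak_difference_quotient[where \<Omega> = \<Omega>]) (use u g weak V in auto)
  have "(\<integral>\<^sup>+x. indicator V x * ennreal ((u (x + h) - u x)\<^sup>2) \<partial>lborel)
     \<le> (\<integral>\<^sup>+x. ennreal ((norm h)\<^sup>2) * (\<integral>\<^sup>+t. indicator {0..1} t * ennreal (N (x + t *\<^sub>R h)) \<partial>lborel) \<partial>lborel)"
  proof (rule nn_integral_mono_AE)
    show "AE x in lborel. indicator V x * ennreal ((u (x + h) - u x)\<^sup>2)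
      \<le> ennreal ((norm h)\<^sup>2) * (\<integral>\<^sup>+t. indicator {0..1} t * ennreal (N (x + t *\<^sub>R h)) \<partial>lborel)"
      using quot
    proof eventually_elim
      case (elim x)
      then show ?case using pt[of x] by (cases "x \<in> V") (simp_all add: G_def)
    qed
  qed
  also have "\<dots> = ennreal ((norm h)\<^sup>2) * (\<integral>\<^sup>+x. \<integral>\<^sup>+t. indicator {0..1} t * ennreal (N (x + t *\<^sub>R h)) \<partial>lborel \<partial>lborel)"
    by (rule nn_integral_cmult) measurable
  also have "(\<integral>\<^sup>+x. \<integral>\<^sup>+t. indicator {0..1} t * ennreal (N (x + t *\<^sub>R h)) \<partial>lborel \<partial>lborel)
    = (\<integral>\<^sup>+t. \<integral>\<^sup>+x. indicator {0..1::real} t * ennreal (N (x + t *\<^sub>R h)) \<partial>lborel \<partial>lborel)"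
    by (rule lborel_pair.Fubini') measurable
  also have "\<dots> = (\<integral>\<^sup>+t. indicator {0..1::real} t * (\<integral>\<^sup>+x. ennreal (N x) \<partial>lborel) \<partial>lborel)"
    using nn_integral_lborel_shift[of "\<lambda>x. ennreal (N x)"] by (simp add: nn_integral_cmult)
  also have "\<dots> = (\<integral>\<^sup>+x. ennreal (N x) \<partial>lborel)"
    by (simp add: nn_integral_multc)
  finally show ?thesis by (simp add: N_def)
qed

section \<open>The weighted double integral of squared differences\<close>

text \<open>Pairs are split by comparing their distance with the boundary distance at either end.
  For close pairs the gradient bound turns the weight into \<open>norm h powr (-s)\<close>. For the
  others the difference is estimated by the values of \<open>u\<close> alone, and part of the
  singularity is absorbed into \<open>layer\<close>. Both remaining kernels have exponents above -2,
  hence are integrable over balls.\<close>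

lemma fractional_energy_finite:
  fixes u :: "'a::euclidean_space \<Rightarrow> real" and g :: "'a \<Rightarrow> 'a \<Rightarrow> real" and \<Omega> :: "'a set"
  assumes dim: "DIM('a) \<ge> 2" and op: "open \<Omega>" and bd: "bounded \<Omega>" and s: "0 < s" "s < 1"
    and u: "integrable lborel u" and g: "\<And>i. i \<in> Basis \<Longrightarrow> integrable lborel (g i)"
    and weak: "\<And>i. i \<in> Basis \<Longrightarrow> lborel_weak_derivative \<Omega> i u (g i)"
    and g2: "(\<integral>\<^sup>+x. ennreal (\<Sum>i\<in>Basis. (g i x)\<^sup>2) \<partial>lborel) < \<infinity>"
    and layer: "(\<integral>\<^sup>+x. indicator \<Omega> x * ennreal ((u x)\<^sup>2 * infdist x (- \<Omega>) powr (- 2 * s)) \<partial>lborel) < \<infinity>"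
  shows "(\<integral>\<^sup>+x. \<integral>\<^sup>+y. ennreal (indicator \<Omega> x * indicator \<Omega> y * ((u y - u x)\<^sup>2 * norm (x - y) powr (- 2 - s))) \<partial>lborel \<partial>lborel) < \<infinity>"
proof -
  have [measurable]: "u \<in> borel_measurable borel" "\<Omega> \<in> sets borel" using u op by auto
  have ne: "- \<Omega> \<noteq> {}" using bd not_bounded_UNIV by (metis Compl_empty_eq double_compl)
  define d where "d = (\<lambda>x. infdist x (- \<Omega>))"
  have dc: "continuous_on UNIV d" unfolding d_def by (intro continuous_on_infdist continuous_on_id)
  then have [measurable]: "d \<in> borel_measurable borel" by (rule borel_measurable_continuous_onI)
  have dpos: "d x > 0" if "x \<in> \<Omega>" for x
    unfolding d_def using that op ne by (intro infdist_pos_not_in_closed) auto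
  have seg: "x + t *\<^sub>R h \<in> \<Omega>" if "norm h < d x" "t \<in> {0..1}" for x h t
  proof (rule ccontr)
    assume "x + t *\<^sub>R h \<notin> \<Omega>"
    then have "d x \<le> dist x (x + t *\<^sub>R h)" unfolding d_def by (intro infdist_le) auto
    also have "\<dots> \<le> norm h" using that(2) by (simp add: dist_norm mult_left_le_one_le)
    finally show False using that(1) by simp
  qed
  obtain R where R: "\<And>x y. x \<in> \<Omega> \<Longrightarrow> y \<in> \<Omega> \<Longrightarrow> norm (x - y) \<le> R"
    using bd by (metis bounded_two_points dist_norm)
  have [measurable]: "cball (0::'a) R \<in> sets borel" by auto
  define K where "K = (\<lambda>x y. indicator \<Omega> x * indicator \<Omega> y * ((u y - u x)\<^sup>2 * norm (x - y) powr (- 2 - s)))"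
  define A where "A = (\<lambda>x y. indicator {z. norm z < d x} (y - x) * K x y)"
  \<comment> \<open>The factor 2 comes from \<open>(u y - u x)\<^sup>2 \<le> 2 * (u x)\<^sup>2 + 2 *
    (u y)\<^sup>2\<close>. Keeping only the term at \<open>x\<close> leaves a function of
    \<open>x - y\<close> for the inner integral; the term at \<open>y\<close> is
    \<open>B y x\<close>.\<close>
  define B where "B = (\<lambda>x y. indicator {z. d x \<le> norm z} (y - x) * (indicator \<Omega> x * indicator \<Omega> y * (2 * (u x)\<^sup>2 * norm (x - y) powr (- 2 - s))))"
  have [measurable]: "(\<lambda>(x, y). ennreal (K x y)) \<in> borel_measurable (borel \<Otimes>\<^sub>M borel)"
    unfolding K_def by measurable
  have Am [measurable]: "(\<lambda>(x, y). ennreal (A x y)) \<in> borel_measurable (borel \<Otimes>\<^sub>M borel)"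
    unfolding A_def K_def by measurable
  have Bm [measurable]: "(\<lambda>(x, y). ennreal (B x y)) \<in> borel_measurable (borel \<Otimes>\<^sub>M borel)"
    unfolding B_def by measurable
  have pos: "K x y \<ge> 0" "A x y \<ge> 0" "B x y \<ge> 0" for x y by (auto simp: K_def A_def B_def)
  have KAB: "K x y \<le> A x y + A y x + (B x y + B y x)" for x y
  proof -
    have sym: "K x y = K y x" by (simp add: K_def norm_minus_commute power2_commute mult.commute)
    \<comment> \<open>Closeness to one end suffices for \<open>A\<close>. In the last case the pair
      is far from both ends, as needed for both \<open>B x y\<close> and \<open>B y x\<close> to be
      active.\<close>
    consider "norm (x - y) < d x" | "norm (x - y) < d y" | "d x \<le> norm (x - y)" "d y \<le> norm (x - y)"
      by linarith
    then show ?thesis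
    proof cases
      case 1
      then have "A x y = K x y" by (simp add: A_def norm_minus_commute)
      then show ?thesis using pos[of x y] pos[of y x] by linarith
    next
      case 2
      then have "A y x = K x y" by (simp add: A_def sym)
      then show ?thesis using pos[of x y] pos[of y x] by linarith
    next
      case 3
      have "0 \<le> (u x + u y)\<^sup>2" by simp
      then have "(u y - u x)\<^sup>2 \<le> 2 * (u x)\<^sup>2 + 2 * (u y)\<^sup>2" by (simp add: power2_eq_square algebra_simps)
      then have "K x y \<le> indicator \<Omega> x * indicator \<Omega> y * ((2 * (u x)\<^sup>2 + 2 * (u y)\<^sup>2) * norm (x - y) powr (- 2 - s))"
        unfolding K_def by (intro mult_left_mono mult_right_mono) auto
      also have "\<dots> = B x y + B y x"
        using 3 by (simp add: B_def norm_minus_commute[of y x] algebra_simps)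
      finally show ?thesis using pos[of x y] pos[of y x] by linarith
    qed
  qed
  let ?C = "\<lambda>a. \<integral>\<^sup>+h. ennreal (norm h powr (- a) * indicator (cball 0 R) h) \<partial>(lborel :: 'a measure)"
  let ?N = "\<integral>\<^sup>+x. ennreal (\<Sum>i\<in>Basis. (g i x)\<^sup>2) \<partial>lborel"
  have C: "?C a < \<infinity>" if "0 \<le> a" "a < 2" for a
    using nn_integral_norm_powr_finite[where 'a = 'a, of a R] that dim by auto
  have IA: "(\<integral>\<^sup>+x. \<integral>\<^sup>+y. ennreal (A x y) \<partial>lborel \<partial>lborel) < \<infinity>"
  proof -
    have "(\<integral>\<^sup>+x. \<integral>\<^sup>+y. ennreal (A x y) \<partial>lborel \<partial>lborel) = (\<integral>\<^sup>+x. \<integral>\<^sup>+h. ennreal (A x (h + x)) \<partial>lborel \<partial>lborel)"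
      by (intro nn_integral_cong nn_integral_lborel_shift[symmetric]) measurable
    also have "\<dots> = (\<integral>\<^sup>+h. \<integral>\<^sup>+x. ennreal (A x (h + x)) \<partial>lborel \<partial>lborel)"
      by (rule lborel_pair.Fubini'[symmetric]) measurable
    also have "\<dots> \<le> (\<integral>\<^sup>+h. ennreal (norm h powr (- s) * indicator (cball 0 R) h) * ?N \<partial>(lborel :: 'a measure))"
    proof (rule nn_integral_mono)
      fix h :: 'a
      define V where "V = {x. norm h < d x}"
      have V: "open V" unfolding V_def using dc by (intro open_Collect_less) auto
      have [measurable]: "V \<in> sets borel" using V by auto
      have "(\<integral>\<^sup>+x. ennreal (A x (h + x)) \<partial>lborel)
        \<le> (\<integral>\<^sup>+x. ennreal (norm h powr (- 2 - s) * indicator (cball 0 R) h) * (indicator V x * ennreal ((u (x + h) - u x)\<^sup>2)) \<partial>lborel)"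
      proof (rule nn_integral_mono)
        fix x
        have "norm h \<le> R" if "x \<in> \<Omega>" "h + x \<in> \<Omega>" using R[OF that(2,1)] by simp
        then have "A x (h + x) \<le> norm h powr (- 2 - s) * indicator (cball 0 R) h * (indicator V x * (u (x + h) - u x)\<^sup>2)"
          by (auto simp: A_def K_def V_def indicator_def add.commute mult.commute)
        then have "ennreal (A x (h + x)) \<le> ennreal (norm h powr (- 2 - s) * indicator (cball 0 R) h * (indicator V x * (u (x + h) - u x)\<^sup>2))"
          by (rule ennreal_leI)
        then show "ennreal (A x (h + x)) \<le> ennreal (norm h powr (- 2 - s) * indicator (cball 0 R) h) * (indicator V x * ennreal ((u (x + h) - u x)\<^sup>2))"
          by (simp add: ennreal_mult ennreal_indicator)
      qed
      also have "\<dots> = ennreal (norm h powr (- 2 - s) * indicator (cball 0 R) h) * (\<integral>\<^sup>+x. indicator V x * ennreal ((u (x + h) - u x)\<^sup>2) \<partial>lborel)"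
        by (rule nn_integral_cmult) measurable
      also have "\<dots> \<le> ennreal (norm h powr (- 2 - s) * indicator (cball 0 R) h) * (ennreal ((norm h)\<^sup>2) * ?N)"
        by (intro mult_left_mono weak_difference_L2_bound[where \<Omega> = \<Omega>] u g weak V) (auto simp: V_def intro: seg)
      also have "\<dots> = ennreal (norm h powr (- s) * indicator (cball 0 R) h) * ?N"
      proof -
        \<comment> \<open>At \<open>h = 0\<close> both sides are 0 by the convention for
          \<open>0 powr\<close>.\<close>
        have "norm h powr (- 2 - s) * (norm h)\<^sup>2 = norm h powr (- s)"
          by (cases "h = 0") (simp_all add: powr_add[symmetric] powr_numeral[symmetric] del: powr_numeral)
        then have "ennreal (norm h powr (- s) * indicator (cball 0 R) h)
            = ennreal (norm h powr (- 2 - s) * indicator (cball 0 R) h * (norm h)\<^sup>2)"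
          by (simp add: indicator_def)
        also have "\<dots> = ennreal (norm h powr (- 2 - s) * indicator (cball 0 R) h) * ennreal ((norm h)\<^sup>2)"
          by (rule ennreal_mult'') simp
        finally show ?thesis by (simp only: mult.assoc)
      qed
      finally show "(\<integral>\<^sup>+x. ennreal (A x (h + x)) \<partial>lborel) \<le> ennreal (norm h powr (- s) * indicator (cball 0 R) h) * ?N" .
    qed
    also have "\<dots> = ?C s * ?N" by (rule nn_integral_multc) measurable
    also have "\<dots> < \<infinity>" using C[of s] s g2 by (simp add: ennreal_mult_less_top less_top)
    finally show ?thesis .
  qed
  have IB: "(\<integral>\<^sup>+x. \<integral>\<^sup>+y. ennreal (B x y) \<partial>lborel \<partial>lborel) < \<infinity>"
  proof -
    have "(\<integral>\<^sup>+x. \<integral>\<^sup>+y. ennreal (B x y) \<partial>lborel \<partial>lborel)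
      \<le> (\<integral>\<^sup>+x. 2 * (indicator \<Omega> x * ennreal ((u x)\<^sup>2 * d x powr (- 2 * s))) * ?C (2 - s) \<partial>lborel)"
    proof (rule nn_integral_mono)
      fix x
      have "(\<integral>\<^sup>+y. ennreal (B x y) \<partial>lborel)
        \<le> (\<integral>\<^sup>+y. 2 * (indicator \<Omega> x * ennreal ((u x)\<^sup>2 * d x powr (- 2 * s))) * ennreal (norm (x - y) powr (- (2 - s)) * indicator (cball 0 R) (x - y)) \<partial>lborel)"
      proof (rule nn_integral_mono)
        fix y
        show "ennreal (B x y) \<le> 2 * (indicator \<Omega> x * ennreal ((u x)\<^sup>2 * d x powr (- 2 * s))) * ennreal (norm (x - y) powr (- (2 - s)) * indicator (cball 0 R) (x - y))"
        proof (cases "x \<in> \<Omega> \<and> y \<in> \<Omega> \<and> d x \<le> norm (y - x)")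
          case True
          then have r: "0 < d x" "d x \<le> norm (x - y)" "norm (x - y) \<le> R"
            using dpos R by (auto simp: norm_minus_commute)
          \<comment> \<open>The exponent \<open>-2 - s\<close> is divided so that
            \<open>-2 * s\<close>, being negative, transfers to the smaller quantity
            \<open>d x\<close>, while \<open>-(2 - s)\<close> remains locally integrable.\<close>
          have "norm (x - y) powr (- 2 - s) = norm (x - y) powr (- 2 * s + - (2 - s))"
            by (rule arg_cong[where f = "\<lambda>c. norm (x - y) powr c"]) simp
          also have "\<dots> = norm (x - y) powr (- 2 * s) * norm (x - y) powr (- (2 - s))" by (rule powr_add)
          also have "\<dots> \<le> d x powr (- 2 * s) * norm (x - y) powr (- (2 - s))"
            using r s by (intro mult_right_mono powr_mono2') auto
          finally have "B x y \<le> 2 * ((u x)\<^sup>2 * d x powr (- 2 * s)) * (norm (x - y) powr (- (2 - s)))"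
            using True by (simp add: B_def mult.assoc mult_left_mono)
          then have "ennreal (B x y) \<le> ennreal (2 * ((u x)\<^sup>2 * d x powr (- 2 * s)) * (norm (x - y) powr (- (2 - s))))"
            by (rule ennreal_leI)
          then show ?thesis using True r by (simp add: ennreal_mult mult.assoc)
        qed (auto simp: B_def)
      qed
      also have "\<dots> = 2 * (indicator \<Omega> x * ennreal ((u x)\<^sup>2 * d x powr (- 2 * s))) * (\<integral>\<^sup>+y. ennreal (norm (x - y) powr (- (2 - s)) * indicator (cball 0 R) (x - y)) \<partial>lborel)"
        by (rule nn_integral_cmult) measurable
      also have "(\<integral>\<^sup>+y. ennreal (norm (x - y) powr (- (2 - s)) * indicator (cball 0 R) (x - y)) \<partial>lborel) = ?C (2 - s)"
        by (rule nn_integral_lborel_diff[of "\<lambda>h. ennreal (norm h powr (- (2 - s)) * indicator (cball 0 R) h)"]) measurable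
      finally show "(\<integral>\<^sup>+y. ennreal (B x y) \<partial>lborel) \<le> 2 * (indicator \<Omega> x * ennreal ((u x)\<^sup>2 * d x powr (- 2 * s))) * ?C (2 - s)" .
    qed
    also have "\<dots> = 2 * (\<integral>\<^sup>+x. indicator \<Omega> x * ennreal ((u x)\<^sup>2 * d x powr (- 2 * s)) \<partial>lborel) * ?C (2 - s)"
      by (simp add: nn_integral_multc nn_integral_cmult)
    also have "\<dots> < \<infinity>" using C[of "2 - s"] s layer by (simp add: d_def ennreal_mult_less_top less_top)
    finally show ?thesis .
  qed
  have "(\<integral>\<^sup>+x. \<integral>\<^sup>+y. ennreal (K x y) \<partial>lborel \<partial>lborel)
    \<le> (\<integral>\<^sup>+x. \<integral>\<^sup>+y. (ennreal (A x y) + ennreal (A y x)) + (ennreal (B x y) + ennreal (B y x)) \<partial>lborel \<partial>lborel)"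
    using KAB pos by (intro nn_integral_mono) (auto simp: ennreal_plus[symmetric] simp del: ennreal_plus intro!: ennreal_leI)
  also have "\<dots> = ((\<integral>\<^sup>+x. \<integral>\<^sup>+y. ennreal (A x y) \<partial>lborel \<partial>lborel) + (\<integral>\<^sup>+x. \<integral>\<^sup>+y. ennreal (A y x) \<partial>lborel \<partial>lborel))
      + ((\<integral>\<^sup>+x. \<integral>\<^sup>+y. ennreal (B x y) \<partial>lborel \<partial>lborel) + (\<integral>\<^sup>+x. \<integral>\<^sup>+y. ennreal (B y x) \<partial>lborel \<partial>lborel))"
    by (simp add: nn_integral_add)
  also have "(\<integral>\<^sup>+x. \<integral>\<^sup>+y. ennreal (A y x) \<partial>lborel \<partial>lborel) = (\<integral>\<^sup>+x. \<integral>\<^sup>+y. ennreal (A x y) \<partial>lborel \<partial>lborel)"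
    by (rule lborel_pair.Fubini') measurable
  also have "(\<integral>\<^sup>+x. \<integral>\<^sup>+y. ennreal (B y x) \<partial>lborel \<partial>lborel) = (\<integral>\<^sup>+x. \<integral>\<^sup>+y. ennreal (B x y) \<partial>lborel \<partial>lborel)"
    by (rule lborel_pair.Fubini') measurable
  finally show ?thesis
    unfolding K_def by (rule le_less_trans) (use IA IB in \<open>simp add: less_top\<close>)
qed

subsection \<open>Integrability of the nonlocal Laplacian\<close>

text \<open>Cauchy-Schwarz with \<open>-2\<close> written as
  \<open>(-2 - s) / 2 + (-2 + s) / 2\<close>: the first half goes with the difference of
  \<open>u\<close>, the second stays alone. The ball indicator costs nothing, since both points lie
  in a set of diameter at most \<open>R\<close>.\<close>

lemma nn_integral_singular_square_le:
  fixes u :: "'a::euclidean_space \<Rightarrow> real" and \<Omega> :: "'a set"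
  assumes [measurable]: "u \<in> borel_measurable borel" "\<Omega> \<in> sets borel"
    and R: "\<And>x y. x \<in> \<Omega> \<Longrightarrow> y \<in> \<Omega> \<Longrightarrow> norm (x - y) \<le> R" and x: "x \<in> \<Omega>"
  shows "(\<integral>\<^sup>+y. ennreal (indicator \<Omega> y * (\<bar>u y - u x\<bar> * norm (x - y) powr (-2))) \<partial>lborel)\<^sup>2
    \<le> (\<integral>\<^sup>+y. ennreal (indicator \<Omega> x * indicator \<Omega> y * ((u y - u x)\<^sup>2 * norm (x - y) powr (- 2 - s))) \<partial>lborel)
      * (\<integral>\<^sup>+h. ennreal (norm h powr (- (2 - s)) * indicator (cball 0 R) h) \<partial>(lborel :: 'a measure))"
proof -
  have [measurable]: "cball (0::'a) R \<in> sets borel" by auto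
  define a where "a = (\<lambda>y. ennreal (indicator \<Omega> y * (\<bar>u y - u x\<bar> * norm (x - y) powr ((- 2 - s) / 2))))"
  define b where "b = (\<lambda>y. ennreal (norm (x - y) powr ((- 2 + s) / 2) * indicator (cball 0 R) (x - y)))"
  have sq: "(r powr (c / 2))\<^sup>2 = r powr c" for r c :: real
    by (simp add: power2_eq_square powr_add[symmetric])
  have [measurable]: "a \<in> borel_measurable borel" "b \<in> borel_measurable borel"
    unfolding a_def b_def by measurable
  have "ennreal (indicator \<Omega> y * (\<bar>u y - u x\<bar> * norm (x - y) powr (-2))) = a y * b y" for y
  proof (cases "y \<in> \<Omega>")
    case True
    have "norm (x - y) powr (- 2) = norm (x - y) powr ((- 2 - s) / 2) * norm (x - y) powr ((- 2 + s) / 2)"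
      by (simp add: powr_add[symmetric] field_simps)
    then show ?thesis using True R[OF x True] by (simp add: a_def b_def ennreal_mult[symmetric] mult.assoc)
  qed (simp add: a_def)
  then have "(\<integral>\<^sup>+y. ennreal (indicator \<Omega> y * (\<bar>u y - u x\<bar> * norm (x - y) powr (-2))) \<partial>lborel)\<^sup>2
    = (\<integral>\<^sup>+y. a y * b y \<partial>lborel)\<^sup>2" by simp
  also have "\<dots> \<le> (\<integral>\<^sup>+y. (a y)\<^sup>2 \<partial>lborel) * (\<integral>\<^sup>+y. (b y)\<^sup>2 \<partial>lborel)"
    by (rule Cauchy_Schwarz_nn_integral) measurable
  also have "(\<lambda>y. (a y)\<^sup>2) = (\<lambda>y. ennreal (indicator \<Omega> x * indicator \<Omega> y * ((u y - u x)\<^sup>2 * norm (x - y) powr (- 2 - s))))"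
    using x by (auto simp: fun_eq_iff a_def indicator_def ennreal_power power_mult_distrib sq)
  also have "(\<lambda>y. (b y)\<^sup>2) = (\<lambda>y. ennreal (norm (x - y) powr (- (2 - s)) * indicator (cball 0 R) (x - y)))"
    by (auto simp: fun_eq_iff b_def indicator_def ennreal_power sq)
  also have "(\<integral>\<^sup>+y. ennreal (norm (x - y) powr (- (2 - s)) * indicator (cball 0 R) (x - y)) \<partial>lborel)
      = (\<integral>\<^sup>+h. ennreal (norm h powr (- (2 - s)) * indicator (cball 0 R) h) \<partial>(lborel :: 'a measure))"
    by (rule nn_integral_lborel_diff[of "\<lambda>h. ennreal (norm h powr (- (2 - s)) * indicator (cball 0 R) h)"]) measurable
  finally show ?thesis .
qed

text \<open>One power of the norm cancels before squaring. The formula extends to the diagonal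
  because \<open>0 powr (-2) = 0\<close> agrees with the value 0 of \<open>alpha_kernel\<close>
  there.\<close>

lemma mu_alpha_kernel:
  assumes "\<And>t. t \<ge> 0 \<Longrightarrow> 0 \<le> \<rho> t"
  shows "mu_kernel (alpha_kernel \<rho>) x y = \<rho> (norm (x - y)) * norm (x - y) powr (-2)"
proof (cases "x = y")
  case False
  define r where "r = norm (x - y)"
  have r: "r > 0" using False by (simp add: r_def)
  have "mu_kernel (alpha_kernel \<rho>) x y = (sqrt (\<rho> r) / r\<^sup>2 * r)\<^sup>2"
    using assms[of r] r by (simp add: mu_kernel_def alpha_kernel_def r_def[symmetric])
  also have "\<dots> = (sqrt (\<rho> r))\<^sup>2 * r powr (-2)"
    using r by (simp add: power_mult_distrib power_divide powr_minus powr_numeral field_simps power2_eq_square)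
  also have "(sqrt (\<rho> r))\<^sup>2 = \<rho> r" using assms[of r] r by simp
  finally show ?thesis by (simp add: r_def)
qed (simp add: mu_kernel_def alpha_kernel_def)

section \<open>Borel representatives and integrability on the domain\<close>

text \<open>A function measurable for the completed measure agrees almost everywhere with a Borel
  one. Joint measurability on products of \<open>lborel\<close> is then available. Multiplying by
  the indicator makes the representative vanish everywhere off the domain, not merely almost
  everywhere.\<close>

lemma lebesgue_on_borel_representative:
  fixes f :: "'a::euclidean_space \<Rightarrow> real"
  assumes f: "f \<in> borel_measurable (lebesgue_on \<Omega>)" and \<Omega>: "\<Omega> \<in> sets borel"
  obtains v where "v \<in> borel_measurable borel" "\<And>x. x \<notin> \<Omega> \<Longrightarrow> v x = 0" "AE x in lebesgue_on \<Omega>. v x = f x"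
proof -
  have L: "\<Omega> \<in> sets lebesgue" using \<Omega> by auto
  have "(\<lambda>x. indicator \<Omega> x *\<^sub>R f x) \<in> borel_measurable lebesgue"
    using f L by (subst (asm) borel_measurable_restrict_space_iff) auto
  from completion_ex_borel_measurable_real[OF this[simplified]]
  obtain w where w: "w \<in> borel_measurable lborel" "AE x in lborel. indicator \<Omega> x * f x = w x" by auto
  have "AE x in lebesgue. x \<in> \<Omega> \<longrightarrow> indicator \<Omega> x * w x = f x"
    using AE_completion[OF w(2)] by eventually_elim auto
  then have "AE x in lebesgue_on \<Omega>. indicator \<Omega> x * w x = f x"
    using L by (simp add: AE_restrict_space_iff)
  then show ?thesis using w(1) \<Omega> by (intro that[of "\<lambda>x. indicator \<Omega> x * w x"]) auto
qed

lemma lebesgue_on_eq_lborel: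
  fixes f :: "'a::euclidean_space \<Rightarrow> real"
  assumes [measurable]: "f \<in> borel_measurable borel" and \<Omega>[measurable]: "\<Omega> \<in> sets borel"
  shows integral_lebesgue_on_borel: "integral\<^sup>L (lebesgue_on \<Omega>) f = (\<integral>x. indicator \<Omega> x * f x \<partial>lborel)"
    and integrable_lebesgue_on_borel: "integrable (lebesgue_on \<Omega>) f \<longleftrightarrow> integrable lborel (\<lambda>x. indicator \<Omega> x * f x)"
    and measurable_lebesgue_on_borel: "f \<in> borel_measurable (lebesgue_on \<Omega>)"
proof -
  have L: "\<Omega> \<inter> space lebesgue \<in> sets lebesgue" using \<Omega> by auto
  show "integral\<^sup>L (lebesgue_on \<Omega>) f = (\<integral>x. indicator \<Omega> x * f x \<partial>lborel)"
    by (simp add: integral_restrict_space[OF L] integral_completion)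
  show "integrable (lebesgue_on \<Omega>) f \<longleftrightarrow> integrable lborel (\<lambda>x. indicator \<Omega> x * f x)"
    by (simp add: integrable_restrict_space[OF L] integrable_completion)
  show "f \<in> borel_measurable (lebesgue_on \<Omega>)"
    by (intro measurable_restrict_space1 measurable_completion) simp
qed

lemma AE_lebesgue_on_borel:
  "\<Omega> \<in> sets borel \<Longrightarrow> (AE x in lebesgue_on \<Omega>. P x) \<longleftrightarrow> (AE x in lborel. x \<in> \<Omega> \<longrightarrow> P x)"
  by (subst AE_restrict_space_iff) (auto simp: AE_completion_iff)

text \<open>Rests on completeness of Lebesgue measure. It gives measurability of
  \<open>nonlocal_laplacian\<close>, which is identified with a Borel function only up to a null
  set.\<close>

lemma measurable_lebesgue_on_AE:
  fixes f g :: "'a::euclidean_space \<Rightarrow> real"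
  assumes f: "f \<in> borel_measurable (lebesgue_on \<Omega>)" and \<Omega>: "\<Omega> \<in> sets borel"
    and ae: "AE x in lebesgue_on \<Omega>. f x = g x"
  shows "g \<in> borel_measurable (lebesgue_on \<Omega>)"
proof -
  have L: "\<Omega> \<inter> space lebesgue \<in> sets lebesgue" using \<Omega> by auto
  have "(\<lambda>x. indicator \<Omega> x *\<^sub>R g x) \<in> borel_measurable lebesgue"
  proof (rule borel_measurable_AE)
    show "(\<lambda>x. indicator \<Omega> x *\<^sub>R f x) \<in> borel_measurable lebesgue"
      using f L by (subst (asm) borel_measurable_restrict_space_iff) auto
    show "AE x in lebesgue. indicator \<Omega> x *\<^sub>R f x = indicator \<Omega> x *\<^sub>R g x"
      using ae \<Omega> by (subst (asm) AE_restrict_space_iff) (auto simp: indicator_def elim: eventually_mono)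
  qed
  then show ?thesis using L by (subst borel_measurable_restrict_space_iff) auto
qed

text \<open>Reduces infinite \<open>p\<close> to a finite exponent: essentially bounded functions on
  a set of finite measure have all finite powers integrable, and 3 is an arbitrary choice above
  2.\<close>

lemma in_Lp_finite_exponent:
  assumes f: "in_Lp p \<Omega> f" and p: "p > 2" and \<Omega>: "open \<Omega>" "bounded \<Omega>"
  obtains q where "q > 2" "integrable (lebesgue_on \<Omega>) (\<lambda>x. \<bar>f x\<bar> powr q)"
proof (cases "p = \<infinity>")
  case True
  interpret finite_measure "lebesgue_on \<Omega>"
    using \<Omega> by (intro finite_measure_lebesgue_on) (auto intro: lmeasurable_open)
  from f True obtain C where C: "AE x in lebesgue_on \<Omega>. \<bar>f x\<bar> \<le> C" by (auto simp: in_Lp_def)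
  have "AE x in lebesgue_on \<Omega>. norm (\<bar>f x\<bar> powr 3) \<le> C powr 3"
    using C by eventually_elim (auto intro: powr_mono2)
  then have "integrable (lebesgue_on \<Omega>) (\<lambda>x. \<bar>f x\<bar> powr 3)"
    using f by (intro integrable_const_bound) (auto simp: in_Lp_def)
  then show ?thesis using that[of 3] by simp
next
  case False
  have "enn2real p > 2"
    using p False by (cases p) (auto simp flip: ennreal_numeral simp: ennreal_less_iff)
  then show ?thesis using f False that by (auto simp: in_Lp_def)
qed

lemma integrable_square_if_powr:
  fixes f :: "'a \<Rightarrow> real"
  assumes "finite_measure M" and [measurable]: "f \<in> borel_measurable M"
    and f: "integrable M (\<lambda>x. \<bar>f x\<bar> powr q)" and q: "q \<ge> 2"
  shows "integrable M (\<lambda>x. (f x)\<^sup>2)" "integrable M f"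
proof -
  interpret finite_measure M by fact
  show sq: "integrable M (\<lambda>x. (f x)\<^sup>2)"
  proof (rule Bochner_Integration.integrable_bound)
    show "integrable M (\<lambda>x. 1 + \<bar>f x\<bar> powr q)" using f by simp
    have "(f x)\<^sup>2 \<le> 1 + \<bar>f x\<bar> powr q" for x
    proof (cases "\<bar>f x\<bar> \<le> 1")
      case True
      then show ?thesis by (simp add: abs_square_le_1 add_increasing2)
    next
      case False
      then have "\<bar>f x\<bar> powr 2 \<le> \<bar>f x\<bar> powr q" using q by (intro powr_mono) auto
      then show ?thesis using False by (simp add: powr_numeral)
    qed
    then show "AE x in M. norm ((f x)\<^sup>2) \<le> norm (1 + \<bar>f x\<bar> powr q)" by (auto intro!: AE_I2 simp: abs_of_nonneg add_nonneg_nonneg)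
  qed measurable
  show "integrable M f"
  proof (rule Bochner_Integration.integrable_bound)
    show "integrable M (\<lambda>x. 1 + (f x)\<^sup>2)" using sq by simp
    have "\<bar>f x\<bar> \<le> 1 + (f x)\<^sup>2" for x
      using zero_le_power2[of "\<bar>f x\<bar> - 1"] by (simp add: power2_eq_square algebra_simps) 
    then show "AE x in M. norm (f x) \<le> norm (1 + (f x)\<^sup>2)" by (auto intro!: AE_I2)
  qed measurable
qed

text \<open>Young's inequality for the conjugate exponents \<open>q / 2\<close> and
  \<open>q / (q - 2)\<close>, without optimal constants. If \<open>b\<close> is below
  \<open>a powr (q - 2)\<close>, the first term dominates; otherwise \<open>a\<close> is bounded by
  a power of \<open>b\<close> and the second does.\<close>

lemma mult_le_powr_add_powr:
  fixes a b q :: real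
  assumes "a \<ge> 0" "b > 0" "q > 2"
  shows "a\<^sup>2 * b \<le> a powr q + b powr (q / (q - 2))"
proof (cases "b \<le> a powr (q - 2)")
  case True
  then have "a > 0" using assms by (cases "a = 0") auto
  have "a\<^sup>2 * b \<le> a\<^sup>2 * a powr (q - 2)" using True by (intro mult_left_mono) auto
  also have "\<dots> = a powr q" using \<open>a > 0\<close> by (simp add: powr_numeral[symmetric] powr_add[symmetric] del: powr_numeral)
  finally show ?thesis by (simp add: add_increasing2)
next
  case False
  have "a powr (q - 2) \<le> b" using False by simp
  then have "(a powr (q - 2)) powr (2 / (q - 2)) \<le> b powr (2 / (q - 2))"
    using assms by (intro powr_mono2) auto
  moreover have "(a powr (q - 2)) powr (2 / (q - 2)) = a powr 2"
  proof -
    have "q - 2 \<noteq> 0" using assms by simp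
    then have "(q - 2) * (2 / (q - 2)) = 2"
      by (simp only: times_divide_eq_right nonzero_mult_div_cancel_left not_False_eq_True)
    then show ?thesis by (simp only: powr_powr)
  qed
  ultimately have "a\<^sup>2 \<le> b powr (2 / (q - 2))" using assms by (simp add: powr_numeral)
  then have "a\<^sup>2 * b \<le> b powr (2 / (q - 2)) * b" using assms by (intro mult_right_mono) auto
  also have "\<dots> = b powr (2 / (q - 2) + 1)" using assms by (simp add: powr_add)
  also have "2 / (q - 2) + 1 = q / (q - 2)" using assms by (simp add: field_simps)
  finally show ?thesis by (simp add: add_increasing)
qed

lemma smooth_on_half_line_continuous:
  assumes "smooth_on_half_line \<rho>"
  shows "continuous_on {0..} \<rho>"
proof -
  obtain D where D: "\<forall>t\<ge>0. D 0 t = \<rho> t" "\<forall>n. \<forall>t\<ge>0. (D n has_real_derivative D (Suc n) t) (at t within {0..})"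
    using assms unfolding smooth_on_half_line_def by blast
  have "continuous_on {0..} (D 0)"
    using D(2) by (auto intro!: DERIV_continuous_on)
  then show ?thesis using D(1) by (subst (asm) continuous_on_cong[OF refl]) auto
qed

lemma test_function_continuous:
  assumes "test_function \<Omega> \<phi>"
  shows "continuous_on UNIV \<phi>" "i \<in> Basis \<Longrightarrow> continuous_on UNIV (\<lambda>x. frechet_derivative \<phi> (at x) i)"
proof -
  have "Ck 0 \<phi>" "Ck (Suc 0) \<phi>" using assms unfolding test_function_def by blast+
  then show "continuous_on UNIV \<phi>" "i \<in> Basis \<Longrightarrow> continuous_on UNIV (\<lambda>x. frechet_derivative \<phi> (at x) i)"
    by auto
qed

text \<open>The parameter \<open>h\<close> treats the power, the square and the identity at once.
  The condition \<open>h 0 = 0\<close> lets the extension by zero carry over to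
  \<open>h (v x)\<close>.\<close>

lemma representative_integrable:
  fixes f v :: "'a::euclidean_space \<Rightarrow> real"
  assumes \<Omega>: "\<Omega> \<in> sets borel" and v: "v \<in> borel_measurable borel" "\<And>x. x \<notin> \<Omega> \<Longrightarrow> v x = 0"
    and ae: "AE x in lebesgue_on \<Omega>. v x = f x"
    and h: "h \<in> borel_measurable borel" "h 0 = 0" and int: "integrable (lebesgue_on \<Omega>) (\<lambda>x. h (f x))"
  shows "integrable lborel (\<lambda>x. h (v x) :: real)"
proof -
  have hv: "(\<lambda>x. h (v x)) \<in> borel_measurable borel" using h v by measurable
  have "integrable (lebesgue_on \<Omega>) (\<lambda>x. h (v x))"
    using int
  proof (rule integrable_cong_AE_imp)
    show "(\<lambda>x. h (v x)) \<in> borel_measurable (lebesgue_on \<Omega>)"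
      by (rule measurable_lebesgue_on_borel[OF hv \<Omega>])
    show "AE x in lebesgue_on \<Omega>. h (f x) = h (v x)" using ae by eventually_elim simp
  qed
  then have "integrable lborel (\<lambda>x. indicator \<Omega> x * h (v x))"
    by (simp add: integrable_lebesgue_on_borel[OF hv \<Omega>])
  moreover have "(\<lambda>x. indicator \<Omega> x * h (v x)) = (\<lambda>x. h (v x))"
    using v(2) h(2) by (auto simp: fun_eq_iff indicator_def)
  ultimately show ?thesis by simp
qed

lemma representative_integral_mult:
  fixes f v w :: "'a::euclidean_space \<Rightarrow> real"
  assumes \<Omega>: "\<Omega> \<in> sets borel" and v: "v \<in> borel_measurable borel" "\<And>x. x \<notin> \<Omega> \<Longrightarrow> v x = 0"
    and ae: "AE x in lebesgue_on \<Omega>. v x = f x" and f: "f \<in> borel_measurable (lebesgue_on \<Omega>)"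
    and w: "w \<in> borel_measurable borel"
  shows "integral\<^sup>L (lebesgue_on \<Omega>) (\<lambda>x. f x * w x) = (\<integral>x. v x * w x \<partial>lborel)"
proof -
  have vw: "(\<lambda>x. v x * w x) \<in> borel_measurable borel" using v w by measurable
  have "integral\<^sup>L (lebesgue_on \<Omega>) (\<lambda>x. f x * w x) = integral\<^sup>L (lebesgue_on \<Omega>) (\<lambda>x. v x * w x)"
  proof (rule integral_cong_AE)
    show "(\<lambda>x. f x * w x) \<in> borel_measurable (lebesgue_on \<Omega>)"
      using f measurable_lebesgue_on_borel[OF w \<Omega>] by measurable
    show "(\<lambda>x. v x * w x) \<in> borel_measurable (lebesgue_on \<Omega>)"
      by (rule measurable_lebesgue_on_borel[OF vw \<Omega>])
    show "AE x in lebesgue_on \<Omega>. f x * w x = v x * w x" using ae by eventually_elim simp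
  qed
  also have "\<dots> = (\<integral>x. indicator \<Omega> x * (v x * w x) \<partial>lborel)"
    by (rule integral_lebesgue_on_borel[OF vw \<Omega>])
  also have "\<dots> = (\<integral>x. v x * w x \<partial>lborel)"
    by (rule Bochner_Integration.integral_cong) (use v(2) in \<open>auto simp: indicator_def\<close>)
  finally show ?thesis .
qed

theorem proposition2p3:
  fixes \<Omega> :: "'a::euclidean_space set" and \<delta> :: real and \<rho> :: "real \<Rightarrow> real"
    and u :: "'a \<Rightarrow> real" and p :: ennreal
  assumes "DIM('a) \<ge> 2"
    and "bounded_lipschitz_domain \<Omega>"
    and "\<delta> > 0"
    and "radial_kernel TYPE('a) \<delta> \<rho>"
    and "p > 2"
    and "in_W1p p \<Omega> u"
  shows "(AE x in lebesgue_on \<Omega>. nonlocal_laplacian_exists_at \<Omega> (alpha_kernel \<rho>) u x) \<and>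
    in_Lp 2 \<Omega> (nonlocal_laplacian \<Omega> (alpha_kernel \<rho>) u)"
proof -
  have op: "open \<Omega>" and bd: "bounded \<Omega>"
    using assms(2) by (auto simp: bounded_lipschitz_domain_def)
  have \<Omega>[measurable]: "\<Omega> \<in> sets borel" using op by auto
  have ne: "- \<Omega> \<noteq> {}" using bd not_bounded_UNIV by (metis Compl_empty_eq double_compl)
  have fin: "finite_measure (lebesgue_on \<Omega>)"
    using op bd by (intro finite_measure_lebesgue_on) (auto intro: lmeasurable_open)
  \<comment> \<open>Used for \<open>u\<close> and for each of its weak derivatives. The exponent
    \<open>q\<close> is kept for \<open>u\<close>, where Young's inequality needs it; for the
    derivatives, integrability of the function and of its square is retained.\<close>
  have rep: "\<exists>v q. v \<in> borel_measurable borel \<and> (\<forall>x. x \<notin> \<Omega> \<longrightarrow> v x = 0) \<and> (AE x in lebesgue_on \<Omega>. v x = f x)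
      \<and> q > 2 \<and> integrable lborel (\<lambda>x. \<bar>v x\<bar> powr q) \<and> integrable lborel (\<lambda>x. (v x)\<^sup>2) \<and> integrable lborel v"
    if f: "in_Lp p \<Omega> f" for f
  proof -
    have fm: "f \<in> borel_measurable (lebesgue_on \<Omega>)" using f by (simp add: in_Lp_def)
    obtain q where q: "q > 2" "integrable (lebesgue_on \<Omega>) (\<lambda>x. \<bar>f x\<bar> powr q)"
      using in_Lp_finite_exponent[OF f assms(5) op bd] by blast
    have f2: "integrable (lebesgue_on \<Omega>) (\<lambda>x. (f x)\<^sup>2)" "integrable (lebesgue_on \<Omega>) f"
      using integrable_square_if_powr[OF fin fm q(2)] q(1) by auto
    obtain v where v: "v \<in> borel_measurable borel" "\<And>x. x \<notin> \<Omega> \<Longrightarrow> v x = 0" "AE x in lebesgue_on \<Omega>. v x = f x"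
      by (rule lebesgue_on_borel_representative[OF fm \<Omega>]) blast
    note R = representative_integrable[OF \<Omega> v]
    have "integrable lborel (\<lambda>x. \<bar>v x\<bar> powr q)" by (rule R[of "\<lambda>r. \<bar>r\<bar> powr q"]) (use q in auto)
    moreover have "integrable lborel (\<lambda>x. (v x)\<^sup>2)" by (rule R[of "\<lambda>r. r\<^sup>2"]) (use f2 in auto)
    moreover have "integrable lborel v" by (rule R[of "\<lambda>r. r"]) (use f2 in auto)
    ultimately show ?thesis using v q(1) by blast
  qed
  have uLp: "in_Lp p \<Omega> u" using assms(6) by (simp add: in_W1p_def)
  have um: "u \<in> borel_measurable (lebesgue_on \<Omega>)" using uLp by (simp add: in_Lp_def)
  obtain v q where v: "v \<in> borel_measurable borel" "\<And>x. x \<notin> \<Omega> \<Longrightarrow> v x = 0" "AE x in lebesgue_on \<Omega>. v x = u x"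
    and q: "q > 2" "integrable lborel (\<lambda>x. \<bar>v x\<bar> powr q)" and vint: "integrable lborel v"
    using rep[OF uLp] by blast
  have vm [measurable]: "v \<in> borel_measurable borel" by fact
  have "\<exists>w. integrable lborel w \<and> integrable lborel (\<lambda>x. (w x)\<^sup>2) \<and> lborel_weak_derivative \<Omega> i v w"
    if i: "i \<in> Basis" for i
  proof -
    obtain g where g: "in_Lp p \<Omega> g" "weak_partial_derivative \<Omega> i u g"
      using assms(6) i by (auto simp: in_W1p_def)
    have gm: "g \<in> borel_measurable (lebesgue_on \<Omega>)" using g by (simp add: in_Lp_def)
    obtain w where w: "w \<in> borel_measurable borel" "\<And>x. x \<notin> \<Omega> \<Longrightarrow> w x = 0" "AE x in lebesgue_on \<Omega>. w x = g x"
      "integrable lborel (\<lambda>x. (w x)\<^sup>2)" "integrable lborel w"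
      using rep[OF g(1)] by blast
    have "lborel_weak_derivative \<Omega> i v w"
      unfolding lborel_weak_derivative_def
    proof (intro allI impI)
      fix \<phi> assume \<phi>: "test_function \<Omega> \<phi>"
      have "(\<integral>x. v x * frechet_derivative \<phi> (at x) i \<partial>lborel)
          = integral\<^sup>L (lebesgue_on \<Omega>) (\<lambda>x. u x * frechet_derivative \<phi> (at x) i)"
        by (rule representative_integral_mult[OF \<Omega> v um, symmetric])
           (auto intro!: borel_measurable_continuous_onI test_function_continuous[OF \<phi>] i)
      also have "\<dots> = - integral\<^sup>L (lebesgue_on \<Omega>) (\<lambda>x. g x * \<phi> x)"
        using g(2) \<phi> by (simp add: weak_partial_derivative_def)
      also have "integral\<^sup>L (lebesgue_on \<Omega>) (\<lambda>x. g x * \<phi> x) = (\<integral>x. w x * \<phi> x \<partial>lborel)"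
        by (rule representative_integral_mult[OF \<Omega> w(1-3) gm])
           (auto intro!: borel_measurable_continuous_onI test_function_continuous[OF \<phi>])
      finally show "(\<integral>x. v x * frechet_derivative \<phi> (at x) i \<partial>lborel) = - (\<integral>x. w x * \<phi> x \<partial>lborel)" .
    qed
    with w show ?thesis by blast
  qed
  then obtain w where w: "\<And>i. i \<in> Basis \<Longrightarrow> integrable lborel (w i)"
    "\<And>i. i \<in> Basis \<Longrightarrow> integrable lborel (\<lambda>x. (w i x)\<^sup>2)"
    "\<And>i. i \<in> Basis \<Longrightarrow> lborel_weak_derivative \<Omega> i v (w i)"
    by metis
  \<comment> \<open>Solves \<open>2 * s * q / (q - 2) = 1/2\<close>, so that Young's inequality
    produces the weight \<open>d x powr (- (1/2))\<close>, covered by the boundary layer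
    estimate.\<close>
  define s where "s = (q - 2) / (4 * q)"
  have s: "0 < s" "s < 1" using q(1) by (auto simp: s_def field_simps)
  define d where "d = (\<lambda>x. infdist x (- \<Omega>))"
  have [measurable]: "d \<in> borel_measurable borel"
    unfolding d_def by (intro borel_measurable_continuous_onI continuous_on_infdist continuous_on_id)
  have "(\<integral>\<^sup>+x. indicator \<Omega> x * ennreal ((v x)\<^sup>2 * d x powr (- 2 * s)) \<partial>lborel)
    \<le> (\<integral>\<^sup>+x. ennreal (\<bar>v x\<bar> powr q) + indicator \<Omega> x * ennreal (d x powr (- (1/2))) \<partial>lborel)"
  proof (rule nn_integral_mono)
    fix x
    show "indicator \<Omega> x * ennreal ((v x)\<^sup>2 * d x powr (- 2 * s))
      \<le> ennreal (\<bar>v x\<bar> powr q) + indicator \<Omega> x * ennreal (d x powr (- (1/2)))"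
    proof (cases "x \<in> \<Omega>")
      case True
      then have "d x > 0" unfolding d_def using op ne by (intro infdist_pos_not_in_closed) auto
      then have "\<bar>v x\<bar>\<^sup>2 * d x powr (- 2 * s) \<le> \<bar>v x\<bar> powr q + (d x powr (- 2 * s)) powr (q / (q - 2))"
        using q(1) by (intro mult_le_powr_add_powr) auto
      also have "(d x powr (- 2 * s)) powr (q / (q - 2)) = d x powr (- (1/2))"
      proof -
        have "(- 2 * s) * (q / (q - 2)) = - (1/2)" using q(1) by (simp add: s_def divide_simps)
        then show ?thesis by (simp only: powr_powr)
      qed
      finally have "ennreal ((v x)\<^sup>2 * d x powr (- 2 * s)) \<le> ennreal (\<bar>v x\<bar> powr q + d x powr (- (1/2)))"
        by (intro ennreal_leI) simp
      then show ?thesis using True by simp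
    qed auto
  qed
  also have "\<dots> = (\<integral>\<^sup>+x. ennreal (\<bar>v x\<bar> powr q) \<partial>lborel) + (\<integral>\<^sup>+x. indicator \<Omega> x * ennreal (d x powr (- (1/2))) \<partial>lborel)"
    by (rule nn_integral_add) measurable
  also have "\<dots> < \<infinity>"
    using q(2) lipschitz_domain_layer[OF assms(2), of "1/2"]
    by (simp add: integrable_iff_bounded d_def less_top)
  finally have layer: "(\<integral>\<^sup>+x. indicator \<Omega> x * ennreal ((v x)\<^sup>2 * infdist x (- \<Omega>) powr (- 2 * s)) \<partial>lborel) < \<infinity>"
    by (simp add: d_def)
  have w2: "(\<integral>\<^sup>+x. ennreal (\<Sum>i\<in>Basis. (w i x)\<^sup>2) \<partial>lborel) < \<infinity>"
  proof -
    have "integrable lborel (\<lambda>x. \<Sum>i\<in>Basis. (w i x)\<^sup>2)" using w(2) by auto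
    then show ?thesis by (simp add: integrable_iff_bounded sum_nonneg abs_of_nonneg)
  qed
  \<comment> \<open>The energy seen from the point \<open>x\<close>. Finiteness of its integral has
    two uses: \<open>E x\<close> is finite almost everywhere, which gives convergence of the
    nonlocal integral, and it dominates the square of the nonlocal Laplacian.\<close>
  define E where "E = (\<lambda>x. \<integral>\<^sup>+y. ennreal (indicator \<Omega> x * indicator \<Omega> y * ((v y - v x)\<^sup>2 * norm (x - y) powr (- 2 - s))) \<partial>lborel)"
  have E: "(\<integral>\<^sup>+x. E x \<partial>lborel) < \<infinity>"
    unfolding E_def by (rule fractional_energy_finite[OF assms(1) op bd s vint w(1,3) w2 layer])
  have Em [measurable]: "E \<in> borel_measurable borel" unfolding E_def by measurable
  have AE_E: "AE x in lborel. E x \<noteq> \<infinity>"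
    using E by (intro nn_integral_PInf_AE) auto
  obtain R where R: "\<And>x y. x \<in> \<Omega> \<Longrightarrow> y \<in> \<Omega> \<Longrightarrow> norm (x - y) \<le> R"
    using bd by (metis bounded_two_points dist_norm)
  define C where "C = (\<integral>\<^sup>+h. ennreal (norm h powr (- (2 - s)) * indicator (cball 0 R) h) \<partial>(lborel :: 'a measure))"
  have C: "C < \<infinity>" unfolding C_def using s assms(1) by (intro nn_integral_norm_powr_finite) auto
  have \<rho>: "continuous_on {0..} \<rho>" "\<And>t. t \<ge> 0 \<Longrightarrow> 0 \<le> \<rho> t"
    using assms(4) smooth_on_half_line_continuous by (auto simp: radial_kernel_def)
  have [measurable]: "(\<lambda>z::'a. \<rho> (norm z)) \<in> borel_measurable borel"
    by (intro borel_measurable_continuous_onI continuous_on_compose2[OF \<rho>(1)]) (auto intro!: continuous_intros)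
  \<comment> \<open>Only distances up to the diameter bound \<open>R\<close> occur within the
    domain, so continuity of the profile on a compact interval suffices.\<close>
  obtain M where M: "\<And>t. t \<in> {0..R} \<Longrightarrow> \<rho> t \<le> M" "M \<ge> 0"
  proof -
    have "compact (\<rho> ` {0..R})"
      by (intro compact_continuous_image continuous_on_subset[OF \<rho>(1)]) auto
    then obtain M where "\<forall>t\<in>{0..R}. \<bar>\<rho> t\<bar> \<le> M" by (auto dest!: compact_imp_bounded simp: bounded_real)
    then show ?thesis by (intro that[of "max M 0"]) (auto simp: le_max_iff_disj abs_le_iff)
  qed
  define k where "k = (\<lambda>x y::'a. \<rho> (norm (x - y)) * norm (x - y) powr (-2))"
  have mu: "mu_kernel (alpha_kernel \<rho>) x y = k x y" for x y :: 'a
    unfolding k_def by (rule mu_alpha_kernel[OF \<rho>(2)])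
  have km [measurable]: "(\<lambda>(x, y). k x y) \<in> borel_measurable (borel \<Otimes>\<^sub>M borel)"
  proof -
    have "(\<lambda>z. \<rho> (norm (fst z - snd z :: 'a))) \<in> borel_measurable (borel \<Otimes>\<^sub>M borel)" by measurable
    then show ?thesis unfolding k_def by measurable
  qed
  define I where "I = (\<lambda>x y. indicator \<Omega> y * ((v y - v x) * k x y))"
  have Im [measurable]: "(\<lambda>(x, y). I x y) \<in> borel_measurable (borel \<Otimes>\<^sub>M borel)"
    unfolding I_def by measurable
  \<comment> \<open>Half the nonlocal Laplacian of the representative \<open>v\<close>, as an
    integral over the whole space, so that its measurability in \<open>x\<close> follows from joint
    measurability of \<open>I\<close>.\<close>
  define L where "L = (\<lambda>x. \<integral>y. I x y \<partial>lborel)"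
  have Lm [measurable]: "L \<in> borel_measurable borel" unfolding L_def by measurable
  \<comment> \<open>Stated for the integral of the absolute value, so that the one estimate yields
    both convergence for finite \<open>E x\<close> and the pointwise bound on
    \<open>L x\<close>.\<close>
  have I2: "(\<integral>\<^sup>+y. ennreal \<bar>I x y\<bar> \<partial>lborel)\<^sup>2 \<le> ennreal (M\<^sup>2) * (E x * C)" if x: "x \<in> \<Omega>" for x
  proof -
    let ?F = "\<lambda>y. ennreal (indicator \<Omega> y * (\<bar>v y - v x\<bar> * norm (x - y) powr (-2)))"
    have "(\<integral>\<^sup>+y. ennreal \<bar>I x y\<bar> \<partial>lborel) \<le> (\<integral>\<^sup>+y. ennreal M * ?F y \<partial>lborel)"
    proof (rule nn_integral_mono)
      fix y
      show "ennreal \<bar>I x y\<bar> \<le> ennreal M * ?F y"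
      proof (cases "y \<in> \<Omega>")
        case True
        have "\<bar>I x y\<bar> = \<rho> (norm (x - y)) * (\<bar>v y - v x\<bar> * norm (x - y) powr (-2))"
          using True \<rho>(2)[of "norm (x - y)"] by (simp add: I_def k_def abs_mult)
        also have "\<dots> \<le> M * (\<bar>v y - v x\<bar> * norm (x - y) powr (-2))"
          using M(1) R[OF x True] by (intro mult_right_mono) auto
        finally show ?thesis using True M(2) by (simp add: ennreal_mult[symmetric] ennreal_leI)
      qed (simp add: I_def)
    qed
    also have "\<dots> = ennreal M * (\<integral>\<^sup>+y. ?F y \<partial>lborel)" by (rule nn_integral_cmult) measurable
    finally have "(\<integral>\<^sup>+y. ennreal \<bar>I x y\<bar> \<partial>lborel)\<^sup>2 \<le> (ennreal M * (\<integral>\<^sup>+y. ?F y \<partial>lborel))\<^sup>2"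
      by (intro power_mono) auto
    also have "\<dots> = ennreal (M\<^sup>2) * (\<integral>\<^sup>+y. ?F y \<partial>lborel)\<^sup>2"
      using M(2) by (simp add: power_mult_distrib ennreal_power)
    also have "\<dots> \<le> ennreal (M\<^sup>2) * (E x * C)"
      unfolding E_def C_def
      by (intro mult_left_mono nn_integral_singular_square_le[OF vm \<Omega> R x]) auto
    finally show ?thesis .
  qed
  have Iint: "integrable lborel (I x)" if "x \<in> \<Omega>" "E x \<noteq> \<infinity>" for x
  proof (rule integrableI_bounded)
    show "I x \<in> borel_measurable lborel" by measurable
    have "(\<integral>\<^sup>+y. ennreal \<bar>I x y\<bar> \<partial>lborel)\<^sup>2 < \<infinity>"
      using I2[OF that(1)] that(2) C by (auto simp: less_top[symmetric] ennreal_mult_eq_top_iff top_unique)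
    then show "(\<integral>\<^sup>+y. ennreal (norm (I x y)) \<partial>lborel) < \<infinity>"
      by (simp add: power_less_top_ennreal)
  qed
  have k1: "(\<lambda>y. k x y) \<in> borel_measurable borel" for x by measurable
  have I1: "(\<lambda>y. (v y - v x) * k x y) \<in> borel_measurable borel" for x by measurable
  have um': "(\<lambda>y. (u y - u x) * k x y) \<in> borel_measurable (lebesgue_on \<Omega>)" for x
    using um measurable_lebesgue_on_borel[OF k1 \<Omega>] by measurable
  \<comment> \<open>Passing from \<open>v\<close> back to \<open>u\<close> involves two exceptional
    sets: \<open>x\<close> must satisfy \<open>v x = u x\<close> exactly, while the integrands in
    \<open>y\<close> need agree only almost everywhere.\<close>
  have vu: "AE y in lebesgue_on \<Omega>. (v y - v x) * k x y = (u y - u x) * k x y" if "v x = u x" for x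
    using v(3) by eventually_elim (simp add: that)
  have "AE x in lebesgue_on \<Omega>. E x \<noteq> \<infinity>"
    using AE_E by (subst AE_lebesgue_on_borel[OF \<Omega>]) (auto elim: eventually_mono)
  then have ex: "AE x in lebesgue_on \<Omega>. nonlocal_laplacian_exists_at \<Omega> (alpha_kernel \<rho>) u x"
    using v(3) AE_space
  proof eventually_elim
    case (elim x)
    then have "integrable lborel (I x)" using Iint by auto
    then have "integrable (lebesgue_on \<Omega>) (\<lambda>y. (v y - v x) * k x y)"
      unfolding I_def integrable_lebesgue_on_borel[OF I1 \<Omega>] .
    then have "integrable (lebesgue_on \<Omega>) (\<lambda>y. (u y - u x) * k x y)"
      by (rule integrable_cong_AE_imp[OF _ um']) (use vu[OF elim(2)] in \<open>auto elim: eventually_mono\<close>)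
    then show ?case by (simp add: nonlocal_laplacian_exists_at_def mu)
  qed
  have eq: "AE x in lebesgue_on \<Omega>. 2 * L x = nonlocal_laplacian \<Omega> (alpha_kernel \<rho>) u x"
    using v(3)
  proof eventually_elim
    case (elim x)
    have "L x = integral\<^sup>L (lebesgue_on \<Omega>) (\<lambda>y. (v y - v x) * k x y)"
      by (simp add: integral_lebesgue_on_borel[OF I1 \<Omega>] L_def I_def)
    also have "\<dots> = integral\<^sup>L (lebesgue_on \<Omega>) (\<lambda>y. (u y - u x) * k x y)"
      by (rule integral_cong_AE[OF measurable_lebesgue_on_borel[OF I1 \<Omega>] um' vu[OF elim]])
    finally show ?case by (simp add: nonlocal_laplacian_def mu)
  qed
  have L2m: "(\<lambda>x. 2 * L x) \<in> borel_measurable borel" "(\<lambda>x. (2 * L x)\<^sup>2) \<in> borel_measurable borel" by measurable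
  have nm: "nonlocal_laplacian \<Omega> (alpha_kernel \<rho>) u \<in> borel_measurable (lebesgue_on \<Omega>)"
    by (rule measurable_lebesgue_on_AE[OF measurable_lebesgue_on_borel[OF L2m(1) \<Omega>] \<Omega> eq])
  have "integrable lborel (\<lambda>x. indicator \<Omega> x * (2 * L x)\<^sup>2)"
  proof (rule integrableI_bounded)
    \<comment> \<open>The factor 4 is the square of the 2 in the definition of the nonlocal
      Laplacian.\<close>
    have "(\<integral>\<^sup>+x. ennreal (norm (indicator \<Omega> x * (2 * L x)\<^sup>2)) \<partial>lborel)
      \<le> (\<integral>\<^sup>+x. ennreal (4 * M\<^sup>2) * C * E x \<partial>lborel)"
    proof (rule nn_integral_mono)
      fix x
      show "ennreal (norm (indicator \<Omega> x * (2 * L x)\<^sup>2)) \<le> ennreal (4 * M\<^sup>2) * C * E x"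
      proof (cases "x \<in> \<Omega>")
        case True
        have "(ennreal \<bar>L x\<bar>)\<^sup>2 \<le> (\<integral>\<^sup>+y. ennreal \<bar>I x y\<bar> \<partial>lborel)\<^sup>2"
          unfolding L_def by (intro power_mono ennreal_abs_integral_le) auto
        also have "\<dots> \<le> ennreal (M\<^sup>2) * (E x * C)" by (rule I2[OF True])
        finally have "4 * (ennreal \<bar>L x\<bar>)\<^sup>2 \<le> 4 * (ennreal (M\<^sup>2) * (E x * C))"
          by (rule mult_left_mono) simp
        then show ?thesis using True
          by (simp add: ennreal_power power_mult_distrib ennreal_mult mult_ac)
      qed simp
    qed
    also have "\<dots> = ennreal (4 * M\<^sup>2) * C * (\<integral>\<^sup>+x. E x \<partial>lborel)" by (rule nn_integral_cmult) measurable
    also have "\<dots> < \<infinity>" using C E by (simp add: ennreal_mult_less_top)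
    finally show "(\<integral>\<^sup>+x. ennreal (norm (indicator \<Omega> x * (2 * L x)\<^sup>2)) \<partial>lborel) < \<infinity>" .
  qed measurable
  then have "integrable (lebesgue_on \<Omega>) (\<lambda>x. (2 * L x)\<^sup>2)"
    unfolding integrable_lebesgue_on_borel[OF L2m(2) \<Omega>] .
  then have "integrable (lebesgue_on \<Omega>) (\<lambda>x. (nonlocal_laplacian \<Omega> (alpha_kernel \<rho>) u x)\<^sup>2)"
  proof (rule integrable_cong_AE_imp)
    show "(\<lambda>x. (nonlocal_laplacian \<Omega> (alpha_kernel \<rho>) u x)\<^sup>2) \<in> borel_measurable (lebesgue_on \<Omega>)"
      using nm by measurable
    show "AE x in lebesgue_on \<Omega>. (2 * L x)\<^sup>2 = (nonlocal_laplacian \<Omega> (alpha_kernel \<rho>) u x)\<^sup>2"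
      using eq by eventually_elim simp
  qed
  then have "in_Lp 2 \<Omega> (nonlocal_laplacian \<Omega> (alpha_kernel \<rho>) u)"
    using nm by (simp add: in_Lp_def powr_numeral)
  with ex show ?thesis ..
qed

end
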